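(* For every real $r\ge 16/5$ there is a constant $C_r>0$, depending only on $r$, such that for every odd prime $p$, every $j\in\mathbb{F}_p^\times$ and every function $f:S_j\to\mathbb{C}$, $$\|(f\,d\sigma_j)^\vee\|_{L^r(\mathbb{F}_p^4)}\le C_r\,\|f\|_{L^2(S_j,d\sigma_j)},$$ that is, $R_{S_j}^*(2\to r)\lesssim_r 1$ for all $r\ge 16/5$.
   Context: For an odd prime $p$, let $\chi:\mathbb{F}_p\to\mathbb{C}^\times$, $\chi(y)=e^{2\pi i y/p}$, and $Q_4(x)=x_1^2+x_2^2+x_3^2+x_4^2$ on $\mathbb{F}_p^4$. For $j\in\mathbb{F}_p^\times$ put $S_j=\{x\in\mathbb{F}_p^4: Q_4(x)=j\}$, with normalized surface measure $d\sigma_j$ (uniform probability measure on $S_j$), so $\|f\|_{L^2(S_j,d\sigma_j)}=\big(\frac1{|S_j|}\sum_{y\in S_j}|f(y)|^2\big)^{1/2}$. The extension operator is $(f\,d\sigma_j)^\vee(x)=\frac1{|S_j|}\sum_{y\in S_j}f(y)\chi(y\cdot x)$ for $x\in\mathbb{F}_p^4$. The space $L^r(\mathbb{F}_p^4)$ is taken with respect to counting measure: $\|g\|_{L^r(\mathbb{F}_p^4)}=\big(\sum_{x\in\mathbb{F}_p^4}|g(x)|^r\big)^{1/r}$. The notation $R_{S_j}^*(2\to r)\lesssim_r1$ means the displayed inequality with constant independent of $p$, $j$ and $f$. *)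

theory Defs
  imports "HOL-Analysis.Analysis" "HOL-Number_Theory.Residues"
begin

text \<open>
  The constant in the theorem must not depend on \<open>p\<close>, so \<open>p\<close> is a term-level parameter and
  the prime field is the carrier of \<open>residue_ring (int p)\<close>, i.e. the integers \<open>0, \<dots>, p - 1\<close>
  with arithmetic modulo \<open>p\<close>; its zero is the integer \<open>0\<close>.
\<close>

definition Fp :: "nat \<Rightarrow> int set" where
  "Fp p = carrier (residue_ring (int p))"

definition Fp4 :: "nat \<Rightarrow> (int ^ 4) set" where
  "Fp4 p = {x. \<forall>i. x $ i \<in> Fp p}"

definition Q4 :: "nat \<Rightarrow> int ^ 4 \<Rightarrow> int" where
  "Q4 p x = (\<Sum>i\<in>UNIV. (x $ i)\<^sup>2) mod int p"

definition dot4 :: "nat \<Rightarrow> int ^ 4 \<Rightarrow> int ^ 4 \<Rightarrow> int" where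
  "dot4 p y x = (\<Sum>i\<in>UNIV. y $ i * x $ i) mod int p"

definition chi :: "nat \<Rightarrow> int \<Rightarrow> complex" where
  "chi p y = exp (2 * of_real pi * \<i> * of_int y / of_nat p)"

definition sphere4 :: "nat \<Rightarrow> int \<Rightarrow> (int ^ 4) set" where
  "sphere4 p j = {x \<in> Fp4 p. Q4 p x = j}"

text \<open>
  A function on the sphere is represented by a function on the whole type; only its values
  on \<open>sphere4 p j\<close> enter the two definitions below.
\<close>

definition sphere_L2_norm :: "nat \<Rightarrow> int \<Rightarrow> (int ^ 4 \<Rightarrow> complex) \<Rightarrow> real" where
  "sphere_L2_norm p j f =
     (1 / real (card (sphere4 p j)) * (\<Sum>y\<in>sphere4 p j. (cmod (f y))\<^sup>2)) powr (1 / 2)"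

definition extension :: "nat \<Rightarrow> int \<Rightarrow> (int ^ 4 \<Rightarrow> complex) \<Rightarrow> int ^ 4 \<Rightarrow> complex" where
  "extension p j f x =
     1 / of_nat (card (sphere4 p j)) * (\<Sum>y\<in>sphere4 p j. f y * chi p (dot4 p y x))"

definition Lr_norm :: "nat \<Rightarrow> real \<Rightarrow> (int ^ 4 \<Rightarrow> complex) \<Rightarrow> real" where
  "Lr_norm p r g = (\<Sum>x\<in>Fp4 p. cmod (g x) powr r) powr (1 / r)"

end

theory Submission
  imports Defs
begin

text \<open>
  Write \<open>hat S f x = \<Sum>y\<in>S. f y * e (y \<cdot> x)\<close> for the extension operator without its normalising
  factor, and let \<open>f\<close> have \<open>\<Sum>|f|\<^sup>2 = 1\<close> on the sphere \<open>S\<close>, which has about \<open>p\<^sup>3\<close> points. The task is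
  \<open>\<Sum>x. |hat S f x| powr (16/5) \<le> C * p powr (24/5)\<close>; exponents beyond \<open>16/5\<close> then follow from
  \<open>|hat S f| \<le> sqrt |S|\<close>. Plancherel gives \<open>\<Sum>x. |hat S f x|\<^sup>2 = p^4\<close>, and this settles all \<open>x\<close> with
  \<open>|hat S f x| \<le> 2 * p powr (2/3)\<close>. For the others it suffices to know that, for \<open>L \<ge> 2 * sqrt p\<close>,
  the level set \<open>|hat S f| > L\<close> has at most \<open>C * (p powr (9/2) / L^3 + p^8 / L^8)\<close> points
  (\<open>level_set_bound\<close>): both terms sum geometrically over dyadic \<open>L\<close> (\<open>weak_to_strong\<close>), the first
  being worst at the largest value \<open>L \<approx> p powr (3/2)\<close> and the second at \<open>L \<approx> p powr (2/3)\<close>.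

  Let \<open>G\<close> be such a level set, with \<open>N\<close> points. By duality \<open>L\<^sup>2 * N\<^sup>2 \<le> \<Sum>y\<in>S. |hat G g y|\<^sup>2\<close> for some \<open>g\<close>
  bounded by \<open>1\<close>. Detecting \<open>S\<close> by characters and completing squares turns the right-hand side
  into a diagonal term and a bilinear form on \<open>G\<close> whose kernel is a combination, with coefficients of
  constant modulus, of the functions \<open>e (k * Q (x - x'))\<close> for \<open>k \<noteq> 0\<close>, where \<open>Q x = x \<cdot> x\<close>. This
  kernel is a Kloosterman sum in \<open>Q (x - x')\<close>. By Hoelder's inequality one needs its action on \<open>g\<close> in the fourth power mean. There \<open>Q (x - x')\<close> is replaced by \<open>Q (x - x') + t\<close> and
  the sum is extended over all \<open>t\<close> in the field. The result is the fourth moment of an exponential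
  sum that is linear in \<open>(x', t)\<close>, so all coefficients may be replaced by \<open>1\<close> (\<open>majorant_l4\<close>), and
  what is left is the fourth moment of \<open>p * |G \<inter> H| - N\<close> over the hyperplanes \<open>H\<close>. The second moment
  is an exact computation, so a bound for \<open>|G \<inter> H|\<close> is enough.

  A hyperplane \<open>v \<cdot> x = b\<close> meets a level set in \<open>O(p\<^sup>3 / L\<^sup>2)\<close> points if every line in direction \<open>v\<close> meets
  \<open>S\<close> in at most two points, since then \<open>hat S f\<close> has mean square \<open>O(p\<^sup>3)\<close> on it. Only for isotropic \<open>v\<close>
  are there longer intersections, namely the lines that lie in the section of \<open>S\<close> by the orthogonal
  complement of \<open>v\<close>. The part of \<open>f\<close> on that section has an extension that exceeds \<open>L / 2\<close> only on a
  set that stays of size \<open>O(p^5 / L^4)\<close> even when the union over all isotropic \<open>v\<close> is taken: the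
  fourth moment of each such extension is controlled by the squared mass of the section (\<open>slice_l4\<close>), and these squared
  masses have a small sum because two points of \<open>S\<close> that are not opposite are orthogonal to only \<open>O(p)\<close>
  isotropic vectors (\<open>slice_mass_sum\<close>). This exceptional set is removed from \<open>G\<close>. The argument uses
  \<open>|f|\<^sup>2 \<le> 1 / p\<close> at each point; the fewer than \<open>p\<close> points where this fails contribute at most
  \<open>sqrt p \<le> L / 2\<close> to \<open>hat S f\<close>.
\<close>

section \<open>Vectors modulo an odd prime\<close>

definition dt :: "int ^ 4 \<Rightarrow> int ^ 4 \<Rightarrow> int" (infix \<open>\<cdot>\<close> 70) where
  "x \<cdot> y = (\<Sum>i\<in>UNIV. x $ i * y $ i)"

lemma dt_commute: "x \<cdot> y = y \<cdot> x"
  by (simp add: dt_def mult.commute)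

lemma dt_add_left: "(x + y) \<cdot> z = x \<cdot> z + y \<cdot> z"
  and dt_add_right: "z \<cdot> (x + y) = z \<cdot> x + z \<cdot> y"
  and dt_diff_left: "(x - y) \<cdot> z = x \<cdot> z - y \<cdot> z"
  and dt_diff_right: "z \<cdot> (x - y) = z \<cdot> x - z \<cdot> y"
  and dt_scale_left: "(c *s x) \<cdot> z = c * (x \<cdot> z)"
  and dt_scale_right: "z \<cdot> (c *s x) = c * (z \<cdot> x)"
  and dt_minus_left: "(- x) \<cdot> z = - (x \<cdot> z)"
  and dt_minus_right: "z \<cdot> (- x) = - (z \<cdot> x)"
  and dt_zero_left: "0 \<cdot> z = 0"
  and dt_zero_right: "z \<cdot> 0 = 0"
  by (simp_all add: dt_def algebra_simps sum.distrib sum_subtractf sum_negf sum_distrib_left)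

lemmas dt_simps = dt_add_left dt_add_right dt_diff_left dt_diff_right dt_scale_left
  dt_scale_right dt_minus_left dt_minus_right dt_zero_left dt_zero_right

text \<open>
  The field varies with \<open>p\<close>, so its elements are integers and vectors are integer vectors, both taken
  modulo \<open>p\<close>. Equality in \<open>F_p^4\<close> is \<open>\<simeq>\<close>, and \<open>red\<close> picks the representative in \<open>Fp4 p\<close>. Linear
  combinations are formed over the integers and reduced only when a member of \<open>Fp4 p\<close> is needed.
\<close>

locale odd_prime =
  fixes p :: nat
  assumes prime_p: "prime p" and odd_p: "odd p"
begin

abbreviation "e \<equiv> chi p"
abbreviation "E \<equiv> Fp4 p"
abbreviation "F \<equiv> {0..<int p}"

definition veq :: "int ^ 4 \<Rightarrow> int ^ 4 \<Rightarrow> bool" (infix \<open>\<simeq>\<close> 50) where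
  "x \<simeq> y \<longleftrightarrow> (\<forall>i. [x $ i = y $ i] (mod int p))"

definition red :: "int ^ 4 \<Rightarrow> int ^ 4" where
  "red x = (\<chi> i. x $ i mod int p)"

lemma p_ge_3: "p \<ge> 3"
proof -
  have "p \<ge> 2" "p \<noteq> 2" using prime_p odd_p prime_ge_2_nat by auto
  thus ?thesis by linarith
qed

lemma p_pos: "p > 0" using p_ge_3 by simp

lemma prime_int: "prime (int p)" using prime_p by simp

lemma Fp_eq: "Fp p = F"
  by (auto simp: Fp_def residue_ring_def)

lemma E_eq: "E = {x. \<forall>i. x $ i \<in> F}"
  by (simp add: Fp4_def Fp_eq)

lemma red_in [simp]: "red x \<in> E"
  using p_pos by (auto simp: red_def E_eq)

lemma red_veq: "red x \<simeq> x"
  by (simp add: red_def veq_def)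

lemma red_id: "x \<in> E \<Longrightarrow> red x = x"
  by (simp add: red_def E_eq vec_eq_iff)

lemma red_eq_iff: "red x = red y \<longleftrightarrow> x \<simeq> y"
  by (simp add: red_def veq_def vec_eq_iff cong_def)

lemma veq_E: "x \<simeq> y \<Longrightarrow> x \<in> E \<Longrightarrow> y \<in> E \<Longrightarrow> x = y"
  using red_eq_iff red_id by metis

lemma veq_refl [simp]: "x \<simeq> x" by (simp add: veq_def)
lemma veq_sym: "x \<simeq> y \<Longrightarrow> y \<simeq> x" by (auto simp: veq_def cong_sym)
lemma veq_trans [trans]: "x \<simeq> y \<Longrightarrow> y \<simeq> z \<Longrightarrow> x \<simeq> z"
  by (auto simp: veq_def intro: cong_trans)
lemma veq_add: "x \<simeq> y \<Longrightarrow> x' \<simeq> y' \<Longrightarrow> x + x' \<simeq> y + y'"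
  by (auto simp: veq_def cong_add)
lemma veq_diff: "x \<simeq> y \<Longrightarrow> x' \<simeq> y' \<Longrightarrow> x - x' \<simeq> y - y'"
  by (auto simp: veq_def cong_diff)
lemma veq_scale: "[c = d] (mod int p) \<Longrightarrow> x \<simeq> y \<Longrightarrow> c *s x \<simeq> d *s y"
  by (auto simp: veq_def cong_mult)
lemma veq_diff_zero: "x \<simeq> y \<longleftrightarrow> x - y \<simeq> 0"
  by (auto simp: veq_def cong_iff_dvd_diff)

lemma veq_dt: "x \<simeq> y \<Longrightarrow> x' \<simeq> y' \<Longrightarrow> [x \<cdot> x' = y \<cdot> y'] (mod int p)"
  unfolding dt_def by (auto simp: veq_def intro!: cong_sum cong_mult)

lemma veq_zero_scale: "c *s x \<simeq> 0 \<longleftrightarrow> int p dvd c \<or> x \<simeq> 0"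
  using prime_int by (auto simp: veq_def cong_iff_dvd_diff prime_dvd_mult_iff)

lemma inverse_mod:
  assumes "\<not> int p dvd c"
  obtains d where "[c * d = 1] (mod int p)"
proof -
  have "coprime c (int p)"
    using assms prime_int by (metis coprime_commute prime_imp_coprime)
  thus ?thesis using that cong_solve_coprime_int by blast
qed

lemma finite_E [simp]: "finite E" and card_E: "card E = p ^ 4"
proof -
  have b: "bij_betw vec_lambda (UNIV \<rightarrow>\<^sub>E F) E"
    by (rule bij_betw_byWitness[where f' = vec_nth])
       (auto simp: E_eq PiE_def extensional_def image_def Pi_def)
  have f: "finite ((UNIV :: 4 set) \<rightarrow>\<^sub>E F)" by (intro finite_PiE) auto
  show "finite E" using b f bij_betw_finite by blast
  have "card E = card ((UNIV :: 4 set) \<rightarrow>\<^sub>E F)" using b bij_betw_same_card by metis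
  also have "\<dots> = p ^ 4" by (subst card_PiE) auto
  finally show "card E = p ^ 4" .
qed

lemma sum_shift:
  fixes f :: "int ^ 4 \<Rightarrow> 'a :: comm_monoid_add"
  assumes f: "\<And>x y. x \<simeq> y \<Longrightarrow> f x = f y"
  shows "(\<Sum>x\<in>E. f (x + h)) = (\<Sum>x\<in>E. f x)"
proof (rule sum.reindex_bij_witness[where i = "\<lambda>x. red (x - h)" and j = "\<lambda>x. red (x + h)"])
  fix x assume x: "x \<in> E"
  have "red (x + h) - h \<simeq> x + h - h" by (intro veq_diff red_veq veq_refl)
  hence "red (x + h) - h \<simeq> x" by simp
  thus "red (red (x + h) - h) = x" using x red_eq_iff red_id by metis
  have "red (x - h) + h \<simeq> x - h + h" by (intro veq_add red_veq veq_refl)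
  hence "red (x - h) + h \<simeq> x" by simp
  thus "red (red (x - h) + h) = x" using x red_eq_iff red_id by metis
  show "f (red (x + h)) = f (x + h)" by (intro f red_veq)
qed auto

lemma sum_shift_F:
  fixes f :: "int \<Rightarrow> 'a :: comm_monoid_add"
  assumes f: "\<And>x y. [x = y] (mod int p) \<Longrightarrow> f x = f y"
  shows "(\<Sum>x\<in>F. f (x + h)) = (\<Sum>x\<in>F. f x)"
  by (rule sum.reindex_bij_witness[where i = "\<lambda>x. (x - h) mod int p" and j = "\<lambda>x. (x + h) mod int p"])
     (use p_pos in \<open>auto simp: mod_simps intro!: f\<close>)

section \<open>Characters and orthogonality\<close>

lemma chi_add: "e (a + b) = e a * e b"
  by (simp add: chi_def exp_add[symmetric] add_divide_distrib distrib_left)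

lemma chi_0 [simp]: "e 0 = 1" by (simp add: chi_def)

lemma norm_chi [simp]: "cmod (e a) = 1"
  by (simp add: chi_def norm_exp_eq_Re)

lemma chi_cis: "e a = cis (2 * pi * a / p)"
  by (simp add: chi_def cis_conv_exp algebra_simps)

lemma cnj_chi: "cnj (e a) = e (- a)"
  by (simp add: chi_cis cis_cnj)

lemma chi_1_iff: "e a = 1 \<longleftrightarrow> int p dvd a"
proof -
  have "e a = 1 \<longleftrightarrow> (\<exists>n::int. 2 * pi * a / p = of_int (2 * n) * pi)"
    unfolding chi_def by (subst exp_eq_1) (auto simp: mult_ac)
  also have "\<dots> \<longleftrightarrow> (\<exists>n::int. real_of_int a = of_int (int p * n))"
    using p_pos by (intro ex_cong1) (auto simp: field_simps)
  also have "\<dots> \<longleftrightarrow> int p dvd a"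
    unfolding of_int_eq_iff by (auto simp: dvd_def)
  finally show ?thesis .
qed

lemma chi_cong: "[a = b] (mod int p) \<Longrightarrow> e a = e b"
proof -
  assume "[a = b] (mod int p)"
  hence "e (a - b) = 1" by (simp add: chi_1_iff cong_iff_dvd_diff)
  thus ?thesis using chi_add[of "a - b" b] by simp
qed

lemma chi_orth_F: "(\<Sum>t\<in>F. e (t * a)) = (if int p dvd a then of_nat p else 0)"
proof (cases "int p dvd a")
  case True
  hence "e (t * a) = 1" for t by (simp add: chi_1_iff)
  thus ?thesis using True by simp
next
  case False
  let ?s = "\<Sum>t\<in>F. e (t * a)"
  have "?s = (\<Sum>t\<in>F. e ((t + 1) * a))"
    by (rule sum_shift_F[symmetric]) (auto intro!: chi_cong cong_mult)
  also have "\<dots> = e a * ?s"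
    by (simp add: algebra_simps chi_add sum_distrib_left)
  finally have "(1 - e a) * ?s = 0" by (simp add: algebra_simps)
  thus ?thesis using False chi_1_iff by auto
qed

lemma chi_orth_E: "(\<Sum>x\<in>E. e (w \<cdot> x)) = (if w \<simeq> 0 then of_nat (p ^ 4) else 0)"
proof (cases "w \<simeq> 0")
  case True
  have "e (w \<cdot> x) = 1" for x
    using veq_dt[OF True veq_refl[of x]] chi_cong by (fastforce simp: dt_zero_left)
  thus ?thesis using True by (simp add: card_E)
next
  case False
  then obtain i where i: "\<not> int p dvd w $ i" by (auto simp: veq_def cong_0_iff)
  let ?s = "\<Sum>x\<in>E. e (w \<cdot> x)"
  let ?h = "axis i 1 :: int ^ 4"
  have h: "w \<cdot> ?h = w $ i" by (simp add: dt_def axis_def if_distrib cong: if_cong)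
  have "?s = (\<Sum>x\<in>E. e (w \<cdot> (x + ?h)))"
    by (rule sum_shift[symmetric]) (auto intro!: chi_cong veq_dt)
  also have "\<dots> = e (w $ i) * ?s"
    by (simp add: dt_simps h chi_add sum_distrib_left mult.commute)
  finally have "(1 - e (w $ i)) * ?s = 0" by (simp add: algebra_simps)
  thus ?thesis using False i chi_1_iff by auto
qed

end

section \<open>Plancherel identity and Gauss sums\<close>

lemma sum_rotate: "(\<Sum>x\<in>X. \<Sum>y\<in>Y. \<Sum>z\<in>Z. f x y z) = (\<Sum>y\<in>Y. \<Sum>z\<in>Z. \<Sum>x\<in>X. f x y z)"
proof -
  have "(\<Sum>x\<in>X. \<Sum>y\<in>Y. \<Sum>z\<in>Z. f x y z) = (\<Sum>y\<in>Y. \<Sum>x\<in>X. \<Sum>z\<in>Z. f x y z)"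
    by (rule sum.swap)
  also have "\<dots> = (\<Sum>y\<in>Y. \<Sum>z\<in>Z. \<Sum>x\<in>X. f x y z)"
    by (intro sum.cong refl sum.swap)
  finally show ?thesis .
qed

context odd_prime
begin

text \<open>
  For \<open>A = S\<close> this is the extension operator, for a set \<open>G\<close> on the physical side it is the Fourier
  transform of \<open>f\<close> restricted to \<open>G\<close>. One notation for both makes duality a matter of exchanging two
  finite sums.
\<close>

definition hat :: "(int ^ 4) set \<Rightarrow> (int ^ 4 \<Rightarrow> complex) \<Rightarrow> int ^ 4 \<Rightarrow> complex" where
  "hat A f x = (\<Sum>y\<in>A. f y * e (y \<cdot> x))"

lemma norm_hat_square:
  "of_real ((cmod (hat A f x))\<^sup>2) = (\<Sum>y\<in>A. \<Sum>y'\<in>A. f y * cnj (f y') * e ((y - y') \<cdot> x))"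
  unfolding complex_norm_square hat_def cnj_sum sum_product
  by (intro sum.cong refl) (simp add: cnj_chi dt_simps chi_add[symmetric] mult_ac)

lemma plancherel:
  assumes A: "A \<subseteq> E"
  shows "(\<Sum>x\<in>E. (cmod (hat A f x))\<^sup>2) = real p ^ 4 * (\<Sum>y\<in>A. (cmod (f y))\<^sup>2)"
proof -
  have fin: "finite A" using A finite_E finite_subset by blast
  have "complex_of_real (\<Sum>x\<in>E. (cmod (hat A f x))\<^sup>2)
      = (\<Sum>x\<in>E. \<Sum>y\<in>A. \<Sum>y'\<in>A. f y * cnj (f y') * e ((y - y') \<cdot> x))"
    by (simp only: of_real_sum norm_hat_square)
  also have "\<dots> = (\<Sum>y\<in>A. \<Sum>y'\<in>A. \<Sum>x\<in>E. f y * cnj (f y') * e ((y - y') \<cdot> x))"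
    by (rule sum_rotate)
  also have "\<dots> = (\<Sum>y\<in>A. \<Sum>y'\<in>A. if y' = y then f y * cnj (f y') * of_nat (p ^ 4) else 0)"
  proof (intro sum.cong refl)
    fix y y' assume "y \<in> A" "y' \<in> A"
    hence "y - y' \<simeq> 0 \<longleftrightarrow> y' = y" using A veq_E veq_diff_zero by (metis subsetD veq_refl)
    thus "(\<Sum>x\<in>E. f y * cnj (f y') * e ((y - y') \<cdot> x))
        = (if y' = y then f y * cnj (f y') * of_nat (p ^ 4) else 0)"
      by (simp add: sum_distrib_left[symmetric] chi_orth_E)
  qed
  also have "\<dots> = (\<Sum>y\<in>A. f y * cnj (f y) * of_nat (p ^ 4))"
    using fin by (simp add: sum.delta)
  also have "\<dots> = complex_of_real (real p ^ 4 * (\<Sum>y\<in>A. (cmod (f y))\<^sup>2))"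
    by (simp only: complex_norm_square[symmetric] of_real_mult of_real_sum sum_distrib_left)
       (simp add: mult.commute)
  finally show ?thesis unfolding of_real_eq_iff .
qed

definition gauss :: "int \<Rightarrow> complex" where
  "gauss s = (\<Sum>y\<in>E. e (s * (y \<cdot> y)))"

lemma not_dvd_4: "\<not> int p dvd s \<Longrightarrow> \<not> int p dvd 4 * s"
proof -
  assume s: "\<not> int p dvd s"
  have "\<not> int p dvd 2"
    using p_ge_3 by (auto dest: zdvd_imp_le)
  hence "\<not> int p dvd 2 * 2" using prime_int prime_dvd_mult_iff by blast
  thus ?thesis using s prime_int prime_dvd_mult_iff[of "int p" 4 s] by simp
qed

lemma not_dvd_2: "\<not> int p dvd s \<Longrightarrow> \<not> int p dvd 2 * s"
  using not_dvd_4[of s] by (metis dvd_mult mult.assoc num_double numeral_times_numeral)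

text \<open>
  In the double sum for the squared modulus, the substitution of \<open>y + y'\<close> for \<open>y\<close> makes the phase linear
  in \<open>y'\<close>, so that only \<open>y = 0\<close> survives.
\<close>

lemma norm_gauss:
  assumes s: "\<not> int p dvd s"
  shows "cmod (gauss s) = real p ^ 2"
proof -
  have "of_real ((cmod (gauss s))\<^sup>2) = (\<Sum>y'\<in>E. \<Sum>y\<in>E. e (s * (y \<cdot> y)) * e (- (s * (y' \<cdot> y'))))"
    unfolding complex_norm_square gauss_def cnj_sum sum_product cnj_chi by (rule sum.swap)
  also have "\<dots> = (\<Sum>y'\<in>E. \<Sum>y\<in>E. e (s * ((y + y') \<cdot> (y + y'))) * e (- (s * (y' \<cdot> y'))))"
    by (intro sum.cong refl sum_shift[symmetric] arg_cong2[where f = "(*)"] chi_cong cong_mult veq_dt) auto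
  also have "\<dots> = (\<Sum>y'\<in>E. \<Sum>y\<in>E. e (s * (y \<cdot> y)) * e (((2 * s) *s y) \<cdot> y'))"
    by (intro sum.cong refl) (simp add: chi_add[symmetric] dt_simps algebra_simps dt_commute)
  also have "\<dots> = (\<Sum>y\<in>E. e (s * (y \<cdot> y)) * (\<Sum>y'\<in>E. e (((2 * s) *s y) \<cdot> y')))"
    by (subst sum.swap) (simp add: sum_distrib_left)
  also have "\<dots> = (\<Sum>y\<in>E. if y = 0 then of_nat (p ^ 4) else 0)"
  proof (intro sum.cong refl)
    fix y assume y: "y \<in> E"
    have "0 \<in> E" using p_pos by (simp add: E_eq)
    hence "(2 * s) *s y \<simeq> 0 \<longleftrightarrow> y = 0"
      using veq_zero_scale not_dvd_2[OF s] y veq_E by (metis veq_refl)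
    thus "e (s * (y \<cdot> y)) * (\<Sum>y'\<in>E. e (((2 * s) *s y) \<cdot> y')) = (if y = 0 then of_nat (p ^ 4) else 0)"
      unfolding chi_orth_E by (simp add: dt_zero_left)
  qed
  also have "\<dots> = of_real ((real p ^ 2)\<^sup>2)"
  proof -
    have "0 \<in> E" using p_pos by (simp add: E_eq)
    thus ?thesis by simp
  qed
  finally have "(cmod (gauss s))\<^sup>2 = (real p ^ 2)\<^sup>2" unfolding of_real_eq_iff .
  thus ?thesis by (rule power2_eq_imp_eq) auto
qed

text \<open>
  The residue of \<open>- 1 / (4 * s)\<close>: completing the square in \<open>s * (y \<cdot> y) + w \<cdot> y\<close> leaves the constant
  \<open>dual s * (w \<cdot> w)\<close>.
\<close>

definition dual :: "int \<Rightarrow> int" where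
  "dual s = (SOME k. k \<in> F \<and> [4 * s * k = - 1] (mod int p))"

lemma dual:
  assumes s: "\<not> int p dvd s"
  shows "dual s \<in> F" "[4 * s * dual s = - 1] (mod int p)"
proof -
  obtain d where d: "[4 * s * d = 1] (mod int p)" using inverse_mod[OF not_dvd_4[OF s]] by blast
  have "[4 * s * (- d mod int p) = 4 * s * (- d)] (mod int p)"
    by (intro cong_mult) (auto simp: cong_def)
  also have "[4 * s * (- d) = - 1] (mod int p)"
    using d by (metis cong_minus_minus_iff mult_minus_right)
  finally have "\<exists>k. k \<in> F \<and> [4 * s * k = - 1] (mod int p)"
    using p_pos by (intro exI[of _ "- d mod int p"]) auto
  from someI_ex[OF this] show "dual s \<in> F" "[4 * s * dual s = - 1] (mod int p)"
    unfolding dual_def by blast+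
qed

lemma dual_bij: "bij_betw dual {1..<int p} {1..<int p}"
proof -
  have nd: "\<not> int p dvd s" if "s \<in> {1..<int p}" for s
    using that zdvd_not_zless by auto
  have inj: "inj_on dual {1..<int p}"
  proof (rule inj_onI)
    fix s t assume st: "s \<in> {1..<int p}" "t \<in> {1..<int p}" "dual s = dual t"
    let ?k = "dual s"
    have "[4 * s * ?k = 4 * t * ?k] (mod int p)"
      using dual(2)[OF nd[OF st(1)]] dual(2)[OF nd[OF st(2)]] st(3) by (metis cong_sym cong_trans)
    hence "int p dvd (s - t) * (4 * ?k)"
      by (simp add: cong_iff_dvd_diff algebra_simps)
    moreover have "\<not> int p dvd 4 * ?k"
    proof
      assume "int p dvd 4 * ?k"
      hence "[4 * s * ?k = 0] (mod int p)" by (simp add: cong_0_iff mult.left_commute mult.assoc)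
      hence "[- 1 = 0] (mod int p)" using dual(2)[OF nd[OF st(1)]] by (metis cong_sym cong_trans)
      thus False using p_ge_3 by (simp add: cong_0_iff zdvd1_eq)
    qed
    ultimately have "int p dvd s - t" using prime_int prime_dvd_mult_iff by blast
    hence "[s = t] (mod int p)" by (simp add: cong_iff_dvd_diff)
    thus "s = t" using st by (auto simp: cong_def)
  qed
  moreover have "dual ` {1..<int p} \<subseteq> {1..<int p}"
  proof
    fix k assume "k \<in> dual ` {1..<int p}"
    then obtain s where s: "s \<in> {1..<int p}" "k = dual s" by blast
    note D = dual[OF nd[OF s(1)], folded s(2)]
    have "k \<noteq> 0"
    proof
      assume "k = 0"
      with D(2) have "int p dvd 1" by (simp add: cong_iff_dvd_diff)
      thus False using p_ge_3 by simp
    qed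
    with D(1) show "k \<in> {1..<int p}" by auto
  qed
  ultimately show ?thesis
    by (simp add: bij_betw_def endo_inj_surj)
qed

lemma gauss_linear:
  assumes s: "\<not> int p dvd s"
  shows "(\<Sum>y\<in>E. e (s * (y \<cdot> y) + w \<cdot> y)) = gauss s * e (dual s * (w \<cdot> w))"
proof -
  let ?k = "dual s"
  have "(\<Sum>y\<in>E. e (s * (y \<cdot> y) + w \<cdot> y))
      = (\<Sum>y\<in>E. e (s * ((y + (2 * ?k) *s w) \<cdot> (y + (2 * ?k) *s w)) + w \<cdot> (y + (2 * ?k) *s w)))"
    by (rule sum_shift[symmetric]) (intro chi_cong cong_add cong_mult veq_dt cong_refl veq_refl)
  also have "\<dots> = (\<Sum>y\<in>E. e (s * (y \<cdot> y) + ?k * (w \<cdot> w)))"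
  proof (intro sum.cong refl chi_cong)
    fix y
    have "int p dvd (4 * s * ?k + 1)"
      using dual(2)[OF s] by (simp add: cong_iff_dvd_diff)
    moreover have "s * ((y + (2 * ?k) *s w) \<cdot> (y + (2 * ?k) *s w)) + w \<cdot> (y + (2 * ?k) *s w)
        - (s * (y \<cdot> y) + ?k * (w \<cdot> w)) = (4 * s * ?k + 1) * (w \<cdot> y + ?k * (w \<cdot> w))"
      by (simp add: dt_simps dt_commute algebra_simps)
    ultimately show "[s * ((y + (2 * ?k) *s w) \<cdot> (y + (2 * ?k) *s w)) + w \<cdot> (y + (2 * ?k) *s w)
        = s * (y \<cdot> y) + ?k * (w \<cdot> w)] (mod int p)"
      unfolding cong_iff_dvd_diff by (metis dvd_mult2)
  qed
  finally show ?thesis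
    by (simp add: chi_add gauss_def sum_distrib_right)
qed

lemma F_split: "F = insert 0 {1..<int p}"
  using p_pos by auto

lemma nd_F: "s \<in> {1..<int p} \<Longrightarrow> \<not> int p dvd s"
  using zdvd_not_zless by auto

lemma sum_F_split: "(\<Sum>t\<in>F. h t) = h 0 + (\<Sum>t\<in>{1..<int p}. h t)"
  by (simp add: F_split)

lemma count_two_equations:
  "of_nat (p ^ 2 * card {x \<in> E. int p dvd a x \<and> int p dvd b x})
     = (\<Sum>s\<in>F. \<Sum>t\<in>F. \<Sum>x\<in>E. e (s * a x + t * b x))"
proof -
  let ?A = "{x \<in> E. int p dvd a x \<and> int p dvd b x}"
  have "(\<Sum>s\<in>F. \<Sum>t\<in>F. \<Sum>x\<in>E. e (s * a x + t * b x))
      = (\<Sum>x\<in>E. \<Sum>s\<in>F. \<Sum>t\<in>F. e (s * a x + t * b x))"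
    by (rule sum_rotate[symmetric])
  also have "\<dots> = (\<Sum>x\<in>E. (\<Sum>s\<in>F. e (s * a x)) * (\<Sum>t\<in>F. e (t * b x)))"
    by (simp only: sum_product chi_add)
  also have "\<dots> = (\<Sum>x\<in>E. if x \<in> ?A then of_nat (p ^ 2) else 0)"
    by (intro sum.cong refl) (auto simp: chi_orth_F power2_eq_square)
  also have "\<dots> = of_nat (p ^ 2 * card ?A)"
    by (subst sum.inter_restrict[symmetric]) (auto simp: Int_def mult.commute)
  finally show ?thesis by simp
qed

text \<open>
  The two equations are detected by characters. The trivial character of the first one gives \<open>p\<^sup>2\<close>;
  every other one gives a Gauss sum of modulus \<open>p\<^sup>2\<close>, and estimating the second sum trivially is
  affordable.
\<close>

lemma card_iso_perp:
  assumes y: "\<not> int p dvd y \<cdot> y"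
  shows "card {v \<in> E. int p dvd v \<cdot> v \<and> int p dvd y \<cdot> v} \<le> 2 * p ^ 2"
proof -
  let ?A = "{v \<in> E. int p dvd v \<cdot> v \<and> int p dvd y \<cdot> v}"
  have y0: "\<not> y \<simeq> 0"
    using y veq_dt[of y 0 y 0] by (auto simp: dt_simps cong_0_iff)
  have "of_nat (p ^ 2 * card ?A) = (\<Sum>s\<in>F. \<Sum>t\<in>F. \<Sum>v\<in>E. e (s * (v \<cdot> v) + (t *s y) \<cdot> v))"
    unfolding count_two_equations dt_scale_left ..
  also have "\<dots> = (\<Sum>t\<in>F. \<Sum>v\<in>E. e ((t *s y) \<cdot> v))
      + (\<Sum>s\<in>{1..<int p}. \<Sum>t\<in>F. \<Sum>v\<in>E. e (s * (v \<cdot> v) + (t *s y) \<cdot> v))"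
    by (subst sum_F_split) simp
  also have "(\<Sum>t\<in>F. \<Sum>v\<in>E. e ((t *s y) \<cdot> v)) = of_nat (p ^ 4)"
  proof -
    have "(\<Sum>t\<in>F. \<Sum>v\<in>E. e ((t *s y) \<cdot> v)) = (\<Sum>t\<in>F. if t = 0 then of_nat (p ^ 4) else 0)"
      using y0 nd_F by (intro sum.cong refl) (auto simp: chi_orth_E veq_zero_scale F_split)
    thus ?thesis using p_pos by simp
  qed
  finally have eq: "of_nat (p ^ 2 * card ?A) = of_nat (p ^ 4) +
      (\<Sum>s\<in>{1..<int p}. \<Sum>t\<in>F. \<Sum>v\<in>E. e (s * (v \<cdot> v) + (t *s y) \<cdot> v))" .
  have "cmod (\<Sum>s\<in>{1..<int p}. \<Sum>t\<in>F. \<Sum>v\<in>E. e (s * (v \<cdot> v) + (t *s y) \<cdot> v))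
     \<le> (\<Sum>s\<in>{1..<int p}. \<Sum>t\<in>F. cmod (\<Sum>v\<in>E. e (s * (v \<cdot> v) + (t *s y) \<cdot> v)))"
    by (intro order_trans[OF norm_sum] sum_mono norm_sum)
  also have "\<dots> = (\<Sum>s\<in>{1..<int p}. \<Sum>t\<in>F. real p ^ 2)"
    by (intro sum.cong refl) (simp only: gauss_linear[OF nd_F] norm_mult norm_gauss[OF nd_F] norm_chi mult_1_right)
  also have "\<dots> \<le> real p ^ 4"
    using p_pos by (simp add: of_nat_diff power2_eq_square power4_eq_xxxx mult_right_mono)
  finally have "cmod (of_nat (p ^ 2 * card ?A)) \<le> real p ^ 4 + real p ^ 4"
    unfolding eq by (intro order_trans[OF norm_triangle_ineq] add_mono) (auto simp: norm_power)
  hence "real (p ^ 2 * card ?A) \<le> real (p ^ 2 * (2 * p ^ 2))"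
    by (simp only: norm_of_nat) (simp add: power2_eq_square power4_eq_xxxx)
  thus ?thesis using p_pos by (simp only: of_nat_le_iff) simp
qed

end

section \<open>The sphere and its Fourier transform\<close>

locale finite_sphere = odd_prime +
  fixes j :: int
  assumes j_nz: "\<not> int p dvd j"
begin

definition S :: "(int ^ 4) set" where
  "S = {y \<in> E. [y \<cdot> y = j] (mod int p)}"

lemma S_sub: "S \<subseteq> E" by (auto simp: S_def)
lemma finite_S [simp]: "finite S" using S_sub finite_E finite_subset by blast
lemma S_nd: "y \<in> S \<Longrightarrow> \<not> int p dvd y \<cdot> y"
  using j_nz by (auto simp: S_def cong_dvd_iff)

lemma sum_S_chi:
  "of_nat p * (\<Sum>y\<in>S. h y) = (\<Sum>t\<in>F. e (- (t * j)) * (\<Sum>y\<in>E. h y * e (t * (y \<cdot> y))))"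
proof -
  have "(\<Sum>t\<in>F. e (- (t * j)) * (\<Sum>y\<in>E. h y * e (t * (y \<cdot> y))))
      = (\<Sum>t\<in>F. \<Sum>y\<in>E. h y * e (t * (y \<cdot> y - j)))"
  proof -
    have "e (- (t * j)) * (h y * e (t * (y \<cdot> y))) = h y * e (t * (y \<cdot> y - j))" for t y
    proof -
      have "e (t * (y \<cdot> y - j)) = e (t * (y \<cdot> y)) * e (- (t * j))"
        by (simp add: chi_add[symmetric] right_diff_distrib)
      thus ?thesis by simp
    qed
    thus ?thesis by (simp only: sum_distrib_left)
  qed
  also have "\<dots> = (\<Sum>y\<in>E. h y * (\<Sum>t\<in>F. e (t * (y \<cdot> y - j))))"
    by (subst sum.swap) (simp add: sum_distrib_left)
  also have "\<dots> = (\<Sum>y\<in>E. if y \<in> S then of_nat p * h y else 0)"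
    by (intro sum.cong refl) (simp add: chi_orth_F S_def cong_iff_dvd_diff)
  also have "\<dots> = of_nat p * (\<Sum>y\<in>S. h y)"
    using S_sub by (subst sum.inter_restrict[symmetric]) (auto simp: Int_absorb1 sum_distrib_left)
  finally show ?thesis by simp
qed

lemma card_S: "real p ^ 3 / 2 \<le> card S" "card S \<le> 2 * real p ^ 3"
proof -
  have "of_nat p * (\<Sum>y\<in>S. 1) = (\<Sum>t\<in>F. e (- (t * j)) * gauss t)"
    unfolding sum_S_chi gauss_def by simp
  also have "\<dots> = of_nat (p ^ 4) + (\<Sum>t\<in>{1..<int p}. e (- (t * j)) * gauss t)"
    unfolding sum_F_split by (simp add: gauss_def card_E)
  finally have eq: "complex_of_real (real p * card S - real p ^ 4) = (\<Sum>t\<in>{1..<int p}. e (- (t * j)) * gauss t)"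
    by simp
  have "cmod (\<Sum>t\<in>{1..<int p}. e (- (t * j)) * gauss t) \<le> (\<Sum>t\<in>{1..<int p}. real p ^ 2)"
    by (intro order_trans[OF norm_sum] sum_mono) (simp add: norm_mult norm_gauss nd_F)
  also have "\<dots> \<le> real p ^ 3"
    using p_pos by (simp add: of_nat_diff power2_eq_square power3_eq_cube mult_right_mono)
  finally have *: "\<bar>real p * card S - real p ^ 4\<bar> \<le> real p ^ 3"
    unfolding eq[symmetric] norm_of_real .
  have p: "real p \<ge> 3" using p_ge_3 by simp
  define q where "q = real p ^ 3"
  have pq: "3 * q \<le> real p * q" "q \<ge> 0" "real p ^ 4 = real p * q"
    using p by (auto simp: q_def power4_eq_xxxx power3_eq_cube intro: mult_right_mono)
  have "\<bar>real p * card S - real p * q\<bar> \<le> q" using * pq(3) q_def by simp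
  hence "real p * (q / 2) \<le> real p * card S" "real p * card S \<le> real p * (2 * q)"
    using pq by (auto simp: abs_le_iff)
  thus "real p ^ 3 / 2 \<le> card S" "card S \<le> 2 * real p ^ 3"
    using p by (simp_all add: mult_le_cancel_left q_def)
qed

text \<open>
  The restriction of a Fourier transform to the sphere, written as a quadratic form: the trivial
  character in the indicator of \<open>S\<close> gives the diagonal term by Plancherel, the others give Gaussian
  kernels in \<open>x - x'\<close> by completing squares.
\<close>

lemma hat_sphere_energy:
  assumes G: "G \<subseteq> E"
  shows "of_real (real p * (\<Sum>y\<in>S. (cmod (hat G g y))\<^sup>2)) = of_real (real p ^ 4 * (\<Sum>x\<in>G. (cmod (g x))\<^sup>2))
    + (\<Sum>x'\<in>G. cnj (g x') * (\<Sum>t\<in>{1..<int p}. e (- (t * j)) * gauss t *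
         (\<Sum>x\<in>G. g x * e (dual t * ((x - x') \<cdot> (x - x'))))))"
proof -
  have "of_real (real p * (\<Sum>y\<in>S. (cmod (hat G g y))\<^sup>2)) = of_nat p * (\<Sum>y\<in>S. complex_of_real ((cmod (hat G g y))\<^sup>2))"
    by (simp del: of_real_power)
  also have "\<dots> = (\<Sum>t\<in>F. e (- (t * j)) * (\<Sum>y\<in>E. of_real ((cmod (hat G g y))\<^sup>2) * e (t * (y \<cdot> y))))"
    by (rule sum_S_chi)
  also have "\<dots> = (\<Sum>y\<in>E. of_real ((cmod (hat G g y))\<^sup>2)) +
     (\<Sum>t\<in>{1..<int p}. e (- (t * j)) * (\<Sum>y\<in>E. of_real ((cmod (hat G g y))\<^sup>2) * e (t * (y \<cdot> y))))"
    by (simp add: sum_F_split del: of_real_power)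
  also have "(\<Sum>y\<in>E. complex_of_real ((cmod (hat G g y))\<^sup>2)) = of_real (real p ^ 4 * (\<Sum>x\<in>G. (cmod (g x))\<^sup>2))"
    by (simp only: of_real_sum[symmetric] plancherel[OF G])
  also have "(\<Sum>t\<in>{1..<int p}. e (- (t * j)) * (\<Sum>y\<in>E. of_real ((cmod (hat G g y))\<^sup>2) * e (t * (y \<cdot> y))))
     = (\<Sum>t\<in>{1..<int p}. e (- (t * j)) * (\<Sum>x'\<in>G. \<Sum>x\<in>G. cnj (g x') * (gauss t * (g x * e (dual t * ((x - x') \<cdot> (x - x')))))))"
  proof (rule sum.cong[OF refl], rule arg_cong2[where f = "(*)", OF refl])
    fix t assume t: "t \<in> {1..<int p}"
    have "(\<Sum>y\<in>E. of_real ((cmod (hat G g y))\<^sup>2) * e (t * (y \<cdot> y)))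
       = (\<Sum>y\<in>E. \<Sum>x\<in>G. \<Sum>x'\<in>G. g x * cnj (g x') * e (t * (y \<cdot> y) + (x - x') \<cdot> y))"
      by (simp only: norm_hat_square sum_distrib_right chi_add) (simp only: mult_ac)
    also have "\<dots> = (\<Sum>x\<in>G. \<Sum>x'\<in>G. g x * cnj (g x') * (\<Sum>y\<in>E. e (t * (y \<cdot> y) + (x - x') \<cdot> y)))"
      by (simp only: sum_distrib_left) (rule sum_rotate)
    also have "\<dots> = (\<Sum>x\<in>G. \<Sum>x'\<in>G. cnj (g x') * (gauss t * (g x * e (dual t * ((x - x') \<cdot> (x - x'))))))"
      by (simp only: gauss_linear[OF nd_F[OF t]]) (simp only: mult_ac)
    also have "\<dots> = (\<Sum>x'\<in>G. \<Sum>x\<in>G. cnj (g x') * (gauss t * (g x * e (dual t * ((x - x') \<cdot> (x - x'))))))"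
      by (rule sum.swap)
    finally show "(\<Sum>y\<in>E. of_real ((cmod (hat G g y))\<^sup>2) * e (t * (y \<cdot> y)))
      = (\<Sum>x'\<in>G. \<Sum>x\<in>G. cnj (g x') * (gauss t * (g x * e (dual t * ((x - x') \<cdot> (x - x'))))))" .
  qed
  also have "\<dots> = (\<Sum>x'\<in>G. cnj (g x') * (\<Sum>t\<in>{1..<int p}. e (- (t * j)) * gauss t *
         (\<Sum>x\<in>G. g x * e (dual t * ((x - x') \<cdot> (x - x'))))))"
    by (simp only: sum_distrib_left, subst sum.swap) (simp only: mult_ac)
  finally show ?thesis .
qed

end

section \<open>Planes and isotropic vectors\<close>

context odd_prime
begin

lemma dvd_dt_red: "int p dvd z \<cdot> red x \<longleftrightarrow> int p dvd z \<cdot> x" "int p dvd red x \<cdot> z \<longleftrightarrow> int p dvd x \<cdot> z"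
  by (rule cong_dvd_iff, intro veq_dt red_veq veq_refl)+

definition indep :: "int ^ 4 \<Rightarrow> int ^ 4 \<Rightarrow> bool" where
  "indep u w \<longleftrightarrow> (\<forall>s t. s *s u + t *s w \<simeq> 0 \<longrightarrow> int p dvd s \<and> int p dvd t)"

definition line :: "int ^ 4 \<Rightarrow> (int ^ 4) set" where
  "line v = {x \<in> E. \<exists>c. x \<simeq> c *s v}"

lemma mod_F: "c mod int p \<in> F" "[c mod int p = c] (mod int p)"
  using p_pos by (auto simp: cong_def)

lemma line_eq: "line v = (\<lambda>c. red (c *s v)) ` F"
proof -
  have "\<exists>c\<in>F. x = red (c *s v)" if "x \<in> E" "x \<simeq> c *s v" for x c
  proof (intro bexI[of _ "c mod int p"])
    have "red x = red ((c mod int p) *s v)"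
      unfolding red_eq_iff using that(2) veq_scale[OF mod_F(2)[of c] veq_refl[of v]]
      by (meson veq_sym veq_trans)
    thus "x = red ((c mod int p) *s v)" using red_id[OF that(1)] by simp
  qed (rule mod_F)
  thus ?thesis by (auto simp: line_def intro: red_veq)
qed

lemma card_line: "card (line v) \<le> p"
  unfolding line_eq using card_image_le[of F] by simp

lemma finite_line [simp]: "finite (line v)" by (simp add: line_def)

lemma indepI:
  assumes v: "\<not> v \<simeq> 0" and w: "\<And>c. \<not> w \<simeq> c *s v"
  shows "indep v w"
  unfolding indep_def
proof (intro allI impI)
  fix s t assume st: "s *s v + t *s w \<simeq> 0"
  have t: "int p dvd t"
  proof (rule ccontr)
    assume "\<not> int p dvd t"
    then obtain d where d: "[t * d = 1] (mod int p)" using inverse_mod by blast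
    have "d *s (s *s v + t *s w) \<simeq> d *s 0" by (intro veq_scale st cong_refl)
    hence "(t * d) *s w - (- (d * s)) *s v \<simeq> 0"
      by (simp add: vector_space_over_itself.scale_scale vec_eq_iff veq_def algebra_simps)
    hence "(t * d) *s w \<simeq> (- (d * s)) *s v" by (simp add: veq_diff_zero[symmetric])
    moreover have "w \<simeq> (t * d) *s w"
      using veq_scale[OF d veq_refl[of w]] veq_sym by simp
    ultimately show False using w veq_trans by blast
  qed
  have "s *s v + t *s w - t *s w \<simeq> 0 - 0"
    using t by (intro veq_diff st) (simp add: veq_zero_scale)
  hence "int p dvd s" using v by (simp add: veq_zero_scale)
  with t show "int p dvd s \<and> int p dvd t" by simp
qed

lemma card_perp2:
  assumes "indep u w"
  shows "card {x \<in> E. int p dvd u \<cdot> x \<and> int p dvd w \<cdot> x} = p ^ 2"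
proof -
  have "of_nat (p ^ 2 * card {x \<in> E. int p dvd u \<cdot> x \<and> int p dvd w \<cdot> x})
      = (\<Sum>s\<in>F. \<Sum>t\<in>F. \<Sum>x\<in>E. e ((s *s u + t *s w) \<cdot> x))"
    unfolding count_two_equations by (simp only: dt_simps)
  also have "\<dots> = (\<Sum>s\<in>F. \<Sum>t\<in>F. if t = 0 then if s = 0 then of_nat (p ^ 4) else 0 else 0)"
  proof (intro sum.cong refl)
    fix s t assume st: "s \<in> F" "t \<in> F"
    have "s *s u + t *s w \<simeq> 0 \<longleftrightarrow> s = 0 \<and> t = 0"
      using assms st nd_F by (auto simp: indep_def F_split)
    thus "(\<Sum>x\<in>E. e ((s *s u + t *s w) \<cdot> x)) = (if t = 0 then if s = 0 then of_nat (p ^ 4) else 0 else (0::complex))"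
      by (simp add: chi_orth_E)
  qed
  also have "\<dots> = of_nat (p ^ 4)" using p_pos by simp
  finally have "p ^ 2 * card {x \<in> E. int p dvd u \<cdot> x \<and> int p dvd w \<cdot> x} = p ^ 2 * p ^ 2"
    unfolding of_nat_eq_iff by (simp only: power2_eq_square power4_eq_xxxx mult.assoc)
  thus ?thesis using p_pos by (subst (asm) mult_left_cancel) auto
qed

lemma F_eqI: "s \<in> F \<Longrightarrow> t \<in> F \<Longrightarrow> int p dvd s - t \<Longrightarrow> s = t"
  by (metis atLeastLessThan_iff mod_eq_dvd_iff mod_pos_pos_trivial)

text \<open>
  The orthogonal complement of two independent vectors and the span of two independent vectors both
  have \<open>p\<^sup>2\<close> elements, so an inclusion between them is an equality.
\<close>

lemma perp2_span:
  assumes uw: "indep u w" and ab: "indep a b"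
    and perp: "int p dvd u \<cdot> a" "int p dvd u \<cdot> b" "int p dvd w \<cdot> a" "int p dvd w \<cdot> b"
    and x: "int p dvd u \<cdot> x" "int p dvd w \<cdot> x"
  obtains s t where "x \<simeq> s *s a + t *s b"
proof -
  let ?W = "{x \<in> E. int p dvd u \<cdot> x \<and> int p dvd w \<cdot> x}"
  let ?h = "\<lambda>(s, t). red (s *s a + t *s b)"
  have inj: "inj_on ?h (F \<times> F)"
  proof (rule inj_onI, clarify)
    fix s t s' t' assume F: "s \<in> F" "t \<in> F" "s' \<in> F" "t' \<in> F"
      and "red (s *s a + t *s b) = red (s' *s a + t' *s b)"
    hence "s *s a + t *s b - (s' *s a + t' *s b) \<simeq> 0"
      by (simp add: red_eq_iff veq_diff_zero[symmetric])
    moreover have "s *s a + t *s b - (s' *s a + t' *s b) = (s - s') *s a + (t - t') *s b"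
      by (simp add: vec_eq_iff algebra_simps)
    ultimately have "(s - s') *s a + (t - t') *s b \<simeq> 0" by (simp only:)
    hence "int p dvd s - s'" "int p dvd t - t'"
      using ab unfolding indep_def by blast+
    thus "s = s' \<and> t = t'" using F F_eqI by blast
  qed
  have "?h ` (F \<times> F) \<subseteq> ?W"
  proof clarify
    fix s t
    show "red (s *s a + t *s b) \<in> E \<and> int p dvd u \<cdot> red (s *s a + t *s b)
       \<and> int p dvd w \<cdot> red (s *s a + t *s b)"
    proof (intro conjI red_in)
      show "int p dvd u \<cdot> red (s *s a + t *s b)" "int p dvd w \<cdot> red (s *s a + t *s b)"
        using perp by (auto simp: dvd_dt_red dt_simps)
    qed
  qed
  moreover have "card (?h ` (F \<times> F)) = card ?W"
    by (simp only: card_image[OF inj] card_perp2[OF uw] card_cartesian_product) (simp add: power2_eq_square)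
  ultimately have eq: "?h ` (F \<times> F) = ?W" by (intro card_subset_eq) auto
  have "red x \<in> ?W" using x by (simp add: dvd_dt_red)
  then obtain s t where "red x = red (s *s a + t *s b)" unfolding eq[symmetric] by auto
  thus ?thesis using that red_eq_iff by blast
qed

text \<open>
  In dimension four a totally isotropic plane is its own orthogonal complement. Hence a point of the
  sphere is never orthogonal to such a plane.
\<close>

lemma isotropic_plane_perp:
  assumes vw: "indep v w" and iso: "int p dvd v \<cdot> v" "int p dvd w \<cdot> w" "int p dvd v \<cdot> w"
    and y: "int p dvd v \<cdot> y" "int p dvd w \<cdot> y"
  shows "int p dvd y \<cdot> y"
proof -
  have "int p dvd w \<cdot> v" using iso dt_commute by simp
  obtain s t where st: "y \<simeq> s *s v + t *s w"
    using perp2_span[OF vw vw] iso y dt_commute by metis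
  have "[y \<cdot> y = (s *s v + t *s w) \<cdot> (s *s v + t *s w)] (mod int p)"
    by (intro veq_dt st)
  moreover have "int p dvd (s *s v + t *s w) \<cdot> (s *s v + t *s w)"
    using iso by (simp add: dt_simps dt_commute[of w v])
  ultimately show ?thesis by (simp add: cong_dvd_iff)
qed

text \<open>
  The vectors in question are the isotropic ones in the plane orthogonal to \<open>y\<close> and \<open>y'\<close>. The quadratic
  form does not vanish identically on this plane, because \<open>y\<close> would then be isotropic, and a nonzero
  binary form vanishes on at most two lines.
\<close>

lemma card_iso_pair:
  assumes yy: "indep y y'" and y: "\<not> int p dvd y \<cdot> y"
  shows "card {v \<in> E. int p dvd v \<cdot> v \<and> int p dvd y \<cdot> v \<and> int p dvd y' \<cdot> v} \<le> 2 * p"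
proof -
  let ?I = "{v \<in> E. int p dvd v \<cdot> v \<and> int p dvd y \<cdot> v \<and> int p dvd y' \<cdot> v}"
  \<comment> \<open>If two isotropic vectors span the plane, the form is a multiple of the product of coordinates.\<close>
  have "\<exists>a b. ?I \<subseteq> line a \<union> line b"
  proof (cases "\<exists>a\<in>?I. \<exists>b\<in>?I. indep a b")
    case True
    then obtain a b where ab: "a \<in> ?I" "b \<in> ?I" "indep a b" by blast
    have nz: "\<not> int p dvd a \<cdot> b"
      using isotropic_plane_perp[OF ab(3), of y] ab y by (auto simp: dt_commute)
    have "x \<in> line a \<union> line b" if x: "x \<in> ?I" for x
    proof -
      obtain s t where st: "x \<simeq> s *s a + t *s b"
        using perp2_span[OF yy ab(3), of x] ab(1,2) x by auto
      have "[x \<cdot> x = (s *s a + t *s b) \<cdot> (s *s a + t *s b)] (mod int p)"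
        by (intro veq_dt st)
      hence "int p dvd (s *s a + t *s b) \<cdot> (s *s a + t *s b)"
        using x by (simp add: cong_dvd_iff)
      moreover have "(s *s a + t *s b) \<cdot> (s *s a + t *s b)
          = s * s * (a \<cdot> a) + t * t * (b \<cdot> b) + 2 * (s * t * (a \<cdot> b))"
        by (simp add: dt_simps dt_commute[of b a] algebra_simps)
      ultimately have "int p dvd 2 * (s * t * (a \<cdot> b))"
        using ab(1,2) by (metis (no_types, lifting) dvd_add dvd_add_right_iff dvd_mult mem_Collect_eq)
      hence "int p dvd s * t * (a \<cdot> b)" using not_dvd_2 by blast
      hence "int p dvd s \<or> int p dvd t" using nz prime_int prime_dvd_mult_iff by blast
      moreover have "x \<in> line b" if "int p dvd s"
      proof -
        have "s *s a \<simeq> 0" using that by (simp add: veq_zero_scale)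
        hence "s *s a + t *s b \<simeq> 0 + t *s b" by (intro veq_add veq_refl)
        thus ?thesis using st x veq_trans by (auto simp: line_def)
      qed
      moreover have "x \<in> line a" if "int p dvd t"
      proof -
        have "t *s b \<simeq> 0" using that by (simp add: veq_zero_scale)
        hence "s *s a + t *s b \<simeq> s *s a + 0" by (intro veq_add veq_refl)
        thus ?thesis using st x veq_trans by (auto simp: line_def)
      qed
      ultimately show ?thesis by blast
    qed
    thus ?thesis by blast
  next
    case no: False
    show ?thesis
    proof (cases "\<exists>a\<in>?I. \<not> a \<simeq> 0")
      case True
      then obtain a where a: "a \<in> ?I" "\<not> a \<simeq> 0" by blast
      hence "?I \<subseteq> line a" using indepI[OF a(2)] no by (fastforce simp: line_def)
      thus ?thesis by blast
    next
      case False
      hence "?I \<subseteq> line 0" by (auto simp: line_def)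
      thus ?thesis by blast
    qed
  qed
  then obtain a b where "?I \<subseteq> line a \<union> line b" by blast
  hence "card ?I \<le> card (line a \<union> line b)" by (intro card_mono) auto
  also have "\<dots> \<le> card (line a) + card (line b)" by (rule card_Un_le)
  also have "\<dots> \<le> 2 * p" using card_line[of a] card_line[of b] by simp
  finally show ?thesis .
qed

end

context finite_sphere
begin

text \<open>
  For nonzero isotropic \<open>v\<close> this section of the sphere is a union of lines in direction \<open>v\<close>, one over each
  point of a conic.
\<close>

definition slice :: "int ^ 4 \<Rightarrow> (int ^ 4) set" where
  "slice v = {y \<in> S. int p dvd v \<cdot> y}"

lemma slice_sub: "slice v \<subseteq> S" by (auto simp: slice_def)

text \<open>
  On the conic underlying the section, a sum \<open>m\<close> of two points that is nonzero there determines them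
  up to order, so \<open>a\<close> is confined to two lines in direction \<open>v\<close>. In coordinates: \<open>a\<close> varies over a
  translate of the plane orthogonal to \<open>v\<close> and \<open>m\<close>, which is spanned by \<open>v\<close> and the difference \<open>w\<close>
  of two solutions, and the condition \<open>a \<cdot> a = j\<close> reads \<open>s * (s - 1) * (w \<cdot> w) = 0\<close> in the coefficient
  \<open>s\<close> of \<open>w\<close>.
\<close>

lemma card_slice_pairs:
  assumes v: "\<not> v \<simeq> 0" "int p dvd v \<cdot> v" and m: "int p dvd v \<cdot> m" "\<And>c. \<not> m \<simeq> c *s v"
  shows "card {a \<in> slice v. red (m - a) \<in> slice v} \<le> 2 * p"
proof -
  let ?R = "{a \<in> slice v. red (m - a) \<in> slice v}"
  have vm: "indep v m" using indepI v(1) m(2) by blast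
  have Rm: "[2 * (m \<cdot> a) = m \<cdot> m] (mod int p)" if "a \<in> ?R" for a
  proof -
    have 1: "[a \<cdot> a = j] (mod int p)" using that by (simp add: slice_def S_def)
    have "[red (m - a) \<cdot> red (m - a) = j] (mod int p)" using that by (simp add: slice_def S_def)
    moreover have "[red (m - a) \<cdot> red (m - a) = (m - a) \<cdot> (m - a)] (mod int p)"
      by (intro veq_dt red_veq)
    ultimately have "[(m - a) \<cdot> (m - a) = j] (mod int p)" by (metis cong_sym cong_trans)
    with 1 have "[(m - a) \<cdot> (m - a) - a \<cdot> a = j - j] (mod int p)" by (intro cong_diff)
    hence "int p dvd m \<cdot> m - 2 * (m \<cdot> a)"
      by (simp add: dt_simps dt_commute[of a m] cong_0_iff)
    thus ?thesis by (simp add: cong_iff_dvd_diff dvd_diff_commute)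
  qed
  have perp: "int p dvd v \<cdot> (a - b)" "int p dvd m \<cdot> (a - b)" if "a \<in> ?R" "b \<in> ?R" for a b
  proof -
    show "int p dvd v \<cdot> (a - b)" using that by (simp add: dt_simps slice_def)
    have "[2 * (m \<cdot> a) = 2 * (m \<cdot> b)] (mod int p)"
      using Rm[OF that(1)] Rm[OF that(2)] by (metis cong_sym cong_trans)
    hence "int p dvd 2 * (m \<cdot> (a - b))" by (simp add: cong_iff_dvd_diff dt_simps algebra_simps)
    thus "int p dvd m \<cdot> (a - b)" using not_dvd_2 by blast
  qed
  let ?L = "\<lambda>a. (\<lambda>x. red (a + x)) ` line v"
  have inL: "a \<in> ?L b" if "a \<in> E" "a - b \<simeq> c *s v" for a b c
  proof
    have r: "red (a - b) \<simeq> c *s v" using that(2) red_veq veq_trans by blast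
    thus "red (a - b) \<in> line v" by (auto simp: line_def)
    have "b + red (a - b) \<simeq> b + (a - b)" by (intro veq_add veq_refl red_veq)
    hence "red (b + red (a - b)) = red a" by (simp add: red_eq_iff)
    thus "a = red (b + red (a - b))" using red_id[OF that(1)] by simp
  qed
  have RE: "a \<in> E" if "a \<in> ?R" for a using that S_sub by (auto simp: slice_def)
  have "\<exists>a b. ?R \<subseteq> ?L a \<union> ?L b"
  proof (cases "\<exists>a0\<in>?R. \<exists>a1\<in>?R. indep v (a1 - a0)")
    case True
    then obtain a0 a1 where a: "a0 \<in> ?R" "a1 \<in> ?R" "indep v (a1 - a0)" by blast
    define w where "w = a1 - a0"
    have w: "int p dvd v \<cdot> w" "int p dvd m \<cdot> w" using perp[OF a(2,1)] by (simp_all add: w_def)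
    have Q: "[a \<cdot> a = j] (mod int p)" if "a \<in> ?R" for a using that by (simp add: slice_def S_def)
    have "a1 \<cdot> a1 = a0 \<cdot> a0 + (2 * (a0 \<cdot> w) + w \<cdot> w)"
      by (simp add: w_def dt_simps dt_commute[of a1 a0])
    moreover have "[a1 \<cdot> a1 = a0 \<cdot> a0] (mod int p)" using Q[OF a(1)] Q[OF a(2)] by (metis cong_sym cong_trans)
    ultimately have w0: "int p dvd 2 * (a0 \<cdot> w) + w \<cdot> w"
      by (simp add: cong_iff_dvd_diff)
    have Qw: "\<not> int p dvd w \<cdot> w"
    proof
      assume ww: "int p dvd w \<cdot> w"
      hence "int p dvd 2 * (a0 \<cdot> w)" using w0 by (simp add: dvd_add_left_iff)
      hence "int p dvd a0 \<cdot> w" using not_dvd_2 by blast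
      hence "int p dvd w \<cdot> a0" by (simp add: dt_commute)
      moreover have "int p dvd v \<cdot> a0" using a(1) by (simp add: slice_def)
      ultimately have "int p dvd a0 \<cdot> a0"
        using isotropic_plane_perp[of v w a0] a(3) v(2) ww w(1) w_def by blast
      thus False using S_nd a(1) by (simp add: slice_def)
    qed
    have "x \<in> ?L a0 \<union> ?L a1" if x: "x \<in> ?R" for x
    proof -
      obtain t s where ts: "x - a0 \<simeq> t *s v + s *s w"
        using perp2_span[OF vm a(3)[folded w_def], of "x - a0"] perp[OF x a(1)] v(2) w m(1)
        by (metis dt_commute)
      let ?z = "a0 + (t *s v + s *s w)"
      have xz: "x \<simeq> ?z"
        using veq_add[OF veq_refl[of a0] ts] by simp
      have "[x \<cdot> x = ?z \<cdot> ?z] (mod int p)" by (intro veq_dt xz)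
      moreover have "[x \<cdot> x = a0 \<cdot> a0] (mod int p)" using Q[OF a(1)] Q[OF x] by (metis cong_sym cong_trans)
      ultimately have d1: "int p dvd ?z \<cdot> ?z - a0 \<cdot> a0"
        by (metis cong_iff_dvd_diff cong_sym cong_trans)
      have "?z \<cdot> ?z - a0 \<cdot> a0 = (2 * t) * (v \<cdot> a0) + (t * t) * (v \<cdot> v) + (2 * t * s) * (v \<cdot> w)
          + s * (2 * (a0 \<cdot> w) + w \<cdot> w) + s * (s - 1) * (w \<cdot> w)"
        by (simp add: dt_simps dt_commute[of a0 v] dt_commute[of w v] dt_commute[of w a0] algebra_simps)
      moreover have "int p dvd (2 * t) * (v \<cdot> a0) + (t * t) * (v \<cdot> v) + (2 * t * s) * (v \<cdot> w)
          + s * (2 * (a0 \<cdot> w) + w \<cdot> w)"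
        using a(1) v(2) w(1) by (intro dvd_add dvd_mult w0) (simp_all add: slice_def)
      ultimately have "int p dvd s * (s - 1) * (w \<cdot> w)"
        using d1 by (metis dvd_add_right_iff)
      hence "int p dvd s \<or> int p dvd s - 1" using Qw prime_int prime_dvd_mult_iff by blast
      thus ?thesis
      proof
        assume "int p dvd s"
        hence "s *s w \<simeq> 0" by (simp add: veq_zero_scale)
        hence "t *s v + s *s w \<simeq> t *s v + 0" by (intro veq_add veq_refl)
        hence "x - a0 \<simeq> t *s v" using ts veq_trans by auto
        thus ?thesis using inL[OF RE[OF x]] by blast
      next
        assume "int p dvd s - 1"
        hence "s *s w \<simeq> 1 *s w" by (intro veq_scale veq_refl) (simp add: cong_iff_dvd_diff)
        hence "t *s v + s *s w \<simeq> t *s v + w" by (intro veq_add veq_refl) simp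
        hence "x - a0 \<simeq> t *s v + w" using ts veq_trans by blast
        from veq_diff[OF this veq_refl[of w]] have "x - a1 \<simeq> t *s v" by (simp add: w_def)
        thus ?thesis using inL[OF RE[OF x]] by blast
      qed
    qed
    thus ?thesis by blast
  next
    case False
    show ?thesis
    proof (cases "?R = {}")
      case True
      thus ?thesis by (metis empty_subsetI)
    next
      case ne: False
      then obtain a0 where a0: "a0 \<in> ?R" by blast
      have "x \<in> ?L a0" if x: "x \<in> ?R" for x
        using False a0 x indepI[OF v(1), of "x - a0"] inL[OF RE[OF x]] by blast
      thus ?thesis by blast
    qed
  qed
  then obtain a b where "?R \<subseteq> ?L a \<union> ?L b" by blast
  hence "card ?R \<le> card (?L a \<union> ?L b)" by (intro card_mono) auto
  also have "\<dots> \<le> card (?L a) + card (?L b)" by (rule card_Un_le)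
  also have "\<dots> \<le> card (line v) + card (line v)" by (intro add_mono card_image_le) auto
  also have "\<dots> \<le> 2 * p" using card_line[of v] by simp
  finally show ?thesis .
qed

end

section \<open>Mean squares on hyperplanes\<close>

text \<open>
  Schur's test for the adjacency matrix of a graph of bounded degree.
\<close>

lemma schur_degree:
  fixes a :: "'b \<Rightarrow> real"
  assumes fin: "finite A"
    and sym: "\<And>x y. R x y \<Longrightarrow> R y x"
    and deg: "\<And>y. y \<in> A \<Longrightarrow> card {y' \<in> A. R y y'} \<le> D"
  shows "(\<Sum>y\<in>A. \<Sum>y'\<in>A. if R y y' then a y * a y' else 0) \<le> real D * (\<Sum>y\<in>A. (a y)\<^sup>2)"
proof -
  have "(\<Sum>y\<in>A. \<Sum>y'\<in>A. if R y y' then a y * a y' else 0)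
     \<le> (\<Sum>y\<in>A. \<Sum>y'\<in>A. (if R y y' then (a y)\<^sup>2 / 2 else 0) + (if R y' y then (a y')\<^sup>2 / 2 else 0))"
  proof (intro sum_mono)
    fix y y'
    have "a y * a y' \<le> (a y)\<^sup>2 / 2 + (a y')\<^sup>2 / 2"
      using sum_squares_bound[of "a y" "a y'"] by simp
    thus "(if R y y' then a y * a y' else 0)
      \<le> (if R y y' then (a y)\<^sup>2 / 2 else 0) + (if R y' y then (a y')\<^sup>2 / 2 else 0)"
      using sym by auto
  qed
  also have "\<dots> = (\<Sum>y\<in>A. \<Sum>y'\<in>A. if R y y' then (a y)\<^sup>2 / 2 else 0)
     + (\<Sum>y\<in>A. \<Sum>y'\<in>A. if R y' y then (a y')\<^sup>2 / 2 else 0)"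
    by (simp only: sum.distrib)
  also have "(\<Sum>y\<in>A. \<Sum>y'\<in>A. if R y' y then (a y')\<^sup>2 / 2 else 0)
     = (\<Sum>y\<in>A. \<Sum>y'\<in>A. if R y y' then (a y)\<^sup>2 / 2 else 0)"
    by (rule sum.swap)
  also have "(\<Sum>y\<in>A. \<Sum>y'\<in>A. if R y y' then (a y)\<^sup>2 / 2 else 0)
      + (\<Sum>y\<in>A. \<Sum>y'\<in>A. if R y y' then (a y)\<^sup>2 / 2 else 0)
     = (\<Sum>y\<in>A. real (card {y' \<in> A. R y y'}) * (a y)\<^sup>2)"
    using fin by (simp add: sum.distrib[symmetric] sum.inter_filter[symmetric] mult.commute)
  also have "\<dots> \<le> (\<Sum>y\<in>A. real D * (a y)\<^sup>2)"
    using deg by (intro sum_mono mult_right_mono) auto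
  finally show ?thesis by (simp add: sum_distrib_left)
qed

context odd_prime
begin

definition hyperplane :: "int ^ 4 \<Rightarrow> int \<Rightarrow> (int ^ 4) set" where
  "hyperplane v b = {x \<in> E. int p dvd v \<cdot> x - b}"

lemma hyperplane_chi_sum:
  assumes v: "\<not> v \<simeq> 0"
  shows "cmod (\<Sum>x\<in>hyperplane v b. e (w \<cdot> x)) \<le> (if \<exists>c. w \<simeq> c *s v then real p ^ 3 else 0)"
proof -
  have "of_nat p * (\<Sum>x\<in>hyperplane v b. e (w \<cdot> x))
      = (\<Sum>x\<in>E. if x \<in> hyperplane v b then of_nat p * e (w \<cdot> x) else 0)"
    by (subst sum.inter_restrict[symmetric]) (auto simp: Int_def hyperplane_def sum_distrib_left conj_commute)
  also have "\<dots> = (\<Sum>x\<in>E. e (w \<cdot> x) * (\<Sum>c\<in>F. e (c * (v \<cdot> x - b))))"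
    by (intro sum.cong refl) (simp add: chi_orth_F hyperplane_def)
  also have "\<dots> = (\<Sum>c\<in>F. \<Sum>x\<in>E. e (w \<cdot> x) * e (c * (v \<cdot> x - b)))"
    by (simp only: sum_distrib_left) (rule sum.swap)
  also have "\<dots> = (\<Sum>c\<in>F. e (- (c * b)) * (\<Sum>x\<in>E. e ((w + c *s v) \<cdot> x)))"
    by (simp add: sum_distrib_left chi_add[symmetric] dt_simps algebra_simps)
  also have "cmod \<dots> \<le> (\<Sum>c\<in>F. if w + c *s v \<simeq> 0 then real p ^ 4 else 0)"
    by (intro order_trans[OF norm_sum] sum_mono) (simp add: norm_mult chi_orth_E norm_power)
  also have "\<dots> \<le> (if \<exists>c. w \<simeq> c *s v then real p ^ 4 else 0)"
  proof (cases "\<exists>c\<in>F. w + c *s v \<simeq> 0")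
    case True
    then obtain c where c: "c \<in> F" "w + c *s v \<simeq> 0" by blast
    have u: "c' = c" if "c' \<in> F" "w + c' *s v \<simeq> 0" for c'
    proof -
      have "(w + c' *s v) - (w + c *s v) \<simeq> 0 - 0" by (intro veq_diff that c)
      moreover have "(w + c' *s v) - (w + c *s v) = (c' - c) *s v" by (simp add: vec_eq_iff algebra_simps)
      ultimately have "(c' - c) *s v \<simeq> 0" by (simp only: diff_0_right)
      hence "int p dvd c' - c" using v veq_zero_scale by blast
      thus ?thesis using F_eqI that(1) c(1) by blast
    qed
    have "w - (- c) *s v \<simeq> 0" using c(2) by (simp add: vector_smult_lneg)
    hence "\<exists>c. w \<simeq> c *s v" using veq_diff_zero by blast
    moreover have "(\<Sum>c\<in>F. if w + c *s v \<simeq> 0 then real p ^ 4 else 0)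
       = (\<Sum>c'\<in>F. if c' = c then real p ^ 4 else 0)"
    proof (rule sum.cong[OF refl])
      fix c' assume "c' \<in> F"
      hence "w + c' *s v \<simeq> 0 \<longleftrightarrow> c' = c" using u c by blast
      thus "(if w + c' *s v \<simeq> 0 then real p ^ 4 else 0) = (if c' = c then real p ^ 4 else 0)" by simp
    qed
    ultimately show ?thesis using c by simp
  next
    case False
    hence "(\<Sum>c\<in>F. if w + c *s v \<simeq> 0 then real p ^ 4 else 0) = 0" by (intro sum.neutral) auto
    thus ?thesis by (simp only:) simp
  qed
  finally have "real p * cmod (\<Sum>x\<in>hyperplane v b. e (w \<cdot> x)) \<le> real p * (if \<exists>c. w \<simeq> c *s v then real p ^ 3 else 0)"
    by (cases "\<exists>c. w \<simeq> c *s v")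
      (simp_all only: norm_mult norm_of_nat if_True if_False power4_eq_xxxx power3_eq_cube mult_ac mult_zero_right)
  thus ?thesis using p_pos by (simp add: mult_le_cancel_left)
qed

text \<open>
  Summing characters over a hyperplane with normal \<open>v\<close> identifies frequencies that differ by a multiple
  of \<open>v\<close>. By the degree hypothesis at most two members of \<open>A\<close> are identified with each other.
\<close>

lemma hyperplane_l2:
  assumes A: "A \<subseteq> E" and v: "\<not> v \<simeq> 0"
    and deg: "\<And>y. y \<in> A \<Longrightarrow> card {y' \<in> A. \<exists>c. y - y' \<simeq> c *s v} \<le> 2"
  shows "(\<Sum>x\<in>hyperplane v b. (cmod (hat A f x))\<^sup>2) \<le> 2 * real p ^ 3 * (\<Sum>y\<in>A. (cmod (f y))\<^sup>2)"
proof -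
  have fin: "finite A" using A finite_E finite_subset by blast
  have sym: "\<exists>c. y' - y \<simeq> c *s v" if yy: "\<exists>c. y - y' \<simeq> c *s v" for y y'
  proof -
    from yy obtain c where "y - y' \<simeq> c *s v" by blast
    hence "(- 1) *s (y - y') \<simeq> (- 1) *s (c *s v)" by (intro veq_scale cong_refl)
    moreover have "(- 1) *s (y - y') = y' - y" "(- 1) *s (c *s v) = (- c) *s v"
      by (simp_all add: vec_eq_iff)
    ultimately show ?thesis by metis
  qed
  have "complex_of_real (\<Sum>x\<in>hyperplane v b. (cmod (hat A f x))\<^sup>2)
      = (\<Sum>x\<in>hyperplane v b. \<Sum>y\<in>A. \<Sum>y'\<in>A. f y * cnj (f y') * e ((y - y') \<cdot> x))"
    by (simp only: of_real_sum norm_hat_square)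
  also have "\<dots> = (\<Sum>y\<in>A. \<Sum>y'\<in>A. f y * cnj (f y') * (\<Sum>x\<in>hyperplane v b. e ((y - y') \<cdot> x)))"
    by (simp only: sum_distrib_left) (rule sum_rotate)
  finally have "cmod (complex_of_real (\<Sum>x\<in>hyperplane v b. (cmod (hat A f x))\<^sup>2))
     \<le> (\<Sum>y\<in>A. \<Sum>y'\<in>A. cmod (f y * cnj (f y') * (\<Sum>x\<in>hyperplane v b. e ((y - y') \<cdot> x))))"
    by (simp only:) (intro order_trans[OF norm_sum] sum_mono norm_sum)
  also have "\<dots> \<le> (\<Sum>y\<in>A. \<Sum>y'\<in>A. real p ^ 3 * (if \<exists>c. y - y' \<simeq> c *s v then cmod (f y) * cmod (f y') else 0))"
  proof (intro sum_mono)
    fix y y'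
    have "cmod (f y) * cmod (f y') * cmod (\<Sum>x\<in>hyperplane v b. e ((y - y') \<cdot> x))
      \<le> cmod (f y) * cmod (f y') * (if \<exists>c. y - y' \<simeq> c *s v then real p ^ 3 else 0)"
      by (intro mult_left_mono hyperplane_chi_sum v) auto
    thus "cmod (f y * cnj (f y') * (\<Sum>x\<in>hyperplane v b. e ((y - y') \<cdot> x)))
      \<le> real p ^ 3 * (if \<exists>c. y - y' \<simeq> c *s v then cmod (f y) * cmod (f y') else 0)"
      by (cases "\<exists>c. y - y' \<simeq> c *s v") (simp_all only: norm_mult complex_mod_cnj if_True if_False mult_ac mult_zero_right)
  qed
  also have "\<dots> = real p ^ 3 * (\<Sum>y\<in>A. \<Sum>y'\<in>A. if \<exists>c. y - y' \<simeq> c *s v then cmod (f y) * cmod (f y') else 0)"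
    by (simp only: sum_distrib_left)
  also have "\<dots> \<le> real p ^ 3 * (real 2 * (\<Sum>y\<in>A. (cmod (f y))\<^sup>2))"
  proof (rule mult_left_mono)
    show "(\<Sum>y\<in>A. \<Sum>y'\<in>A. if \<exists>c. y - y' \<simeq> c *s v then cmod (f y) * cmod (f y') else 0)
        \<le> real 2 * (\<Sum>y\<in>A. (cmod (f y))\<^sup>2)"
      by (rule schur_degree[OF fin, of "\<lambda>y y'. \<exists>c. y - y' \<simeq> c *s v", OF sym deg])
  qed simp
  finally have "(\<Sum>x\<in>hyperplane v b. (cmod (hat A f x))\<^sup>2) \<le> real p ^ 3 * (real 2 * (\<Sum>y\<in>A. (cmod (f y))\<^sup>2))"
    unfolding norm_of_real by (rule abs_le_D1)
  thus ?thesis by (simp only: of_nat_numeral mult_ac)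
qed

section \<open>Fourth moments on isotropic sections\<close>

text \<open>
  The additive convolution of \<open>f\<close> with itself on \<open>A\<close>, whose Fourier transform is the square of
  \<open>hat A f\<close>; it makes the fourth moment of \<open>hat A f\<close> a mean square.
\<close>

definition conv :: "(int ^ 4) set \<Rightarrow> (int ^ 4 \<Rightarrow> complex) \<Rightarrow> int ^ 4 \<Rightarrow> complex" where
  "conv A f m = (\<Sum>a\<in>A. f a * (if red (m - a) \<in> A then f (red (m - a)) else 0))"

lemma sum_reflect: "(\<Sum>a\<in>E. h (red (m - a))) = (\<Sum>a\<in>E. h a)"
proof (rule sum.reindex_bij_witness[where i = "\<lambda>a. red (m - a)" and j = "\<lambda>a. red (m - a)"])
  fix a assume a: "a \<in> E"
  have "m - red (m - a) \<simeq> m - (m - a)" by (intro veq_diff veq_refl red_veq)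
  hence "red (m - red (m - a)) = red a" by (simp add: red_eq_iff)
  thus "red (m - red (m - a)) = a" using a red_id by simp
  thus "red (m - red (m - a)) = a" .
qed auto

lemma hat_square:
  assumes A: "A \<subseteq> E"
  shows "(hat A f x)\<^sup>2 = hat E (conv A f) x"
proof -
  let ?f = "\<lambda>b. if b \<in> A then f b else 0"
  have "hat E (conv A f) x = (\<Sum>a\<in>A. \<Sum>m\<in>E. f a * ?f (red (m - a)) * e (m \<cdot> x))"
    unfolding hat_def conv_def sum_distrib_right by (rule sum.swap)
  also have "\<dots> = (\<Sum>a\<in>A. \<Sum>m\<in>E. f a * ?f (red ((m + a) - a)) * e ((m + a) \<cdot> x))"
  proof (rule sum.cong[OF refl])
    fix a
    show "(\<Sum>m\<in>E. f a * ?f (red (m - a)) * e (m \<cdot> x))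
       = (\<Sum>m\<in>E. f a * ?f (red ((m + a) - a)) * e ((m + a) \<cdot> x))"
    proof (rule sum_shift[symmetric, where f = "\<lambda>m. f a * ?f (red (m - a)) * e (m \<cdot> x)"])
      fix m m' :: "int ^ 4" assume mm: "m \<simeq> m'"
      have "red (m - a) = red (m' - a)" unfolding red_eq_iff by (intro veq_diff mm veq_refl)
      moreover have "e (m \<cdot> x) = e (m' \<cdot> x)" by (intro chi_cong veq_dt mm veq_refl)
      ultimately show "f a * ?f (red (m - a)) * e (m \<cdot> x) = f a * ?f (red (m' - a)) * e (m' \<cdot> x)"
        by (simp only:)
    qed
  qed
  also have "\<dots> = (\<Sum>a\<in>A. \<Sum>b\<in>E. if b \<in> A then f a * e (a \<cdot> x) * (f b * e (b \<cdot> x)) else 0)"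
    by (intro sum.cong refl) (simp add: red_id dt_simps chi_add)
  also have "\<dots> = (\<Sum>a\<in>A. \<Sum>b\<in>A. f a * e (a \<cdot> x) * (f b * e (b \<cdot> x)))"
    using A by (subst sum.inter_restrict[symmetric]) (auto simp: Int_absorb1)
  also have "\<dots> = (hat A f x)\<^sup>2"
    by (simp add: hat_def power2_eq_square sum_product)
  finally show ?thesis by simp
qed

lemma fourth_moment:
  assumes A: "A \<subseteq> E"
  shows "(\<Sum>x\<in>E. (cmod (hat A f x)) ^ 4) = real p ^ 4 * (\<Sum>m\<in>E. (cmod (conv A f m))\<^sup>2)"
proof -
  have "(cmod (hat A f x)) ^ 4 = (cmod (hat E (conv A f) x))\<^sup>2" for x
    unfolding hat_square[OF A, symmetric] by (simp add: norm_power)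
  thus ?thesis by (simp only: plancherel[OF subset_refl])
qed

end

context finite_sphere
begin

text \<open>
  The additive energy of the section. A sum \<open>m\<close> outside the line of \<open>v\<close> has \<open>O(p)\<close> representations by
  \<open>card_slice_pairs\<close>, so Cauchy-Schwarz loses a factor \<open>O(p)\<close>. A sum on the line of \<open>v\<close> may have
  \<open>p\<^sup>2\<close> representations, by pairs of opposite lines, but there are at most \<open>p\<close> such \<open>m\<close>.
\<close>

lemma slice_l4:
  assumes v: "\<not> v \<simeq> 0" "int p dvd v \<cdot> v"
  shows "(\<Sum>x\<in>E. (cmod (hat (slice v) f x)) ^ 4) \<le> 3 * real p ^ 5 * (\<Sum>y\<in>slice v. (cmod (f y))\<^sup>2)\<^sup>2"
proof -
  let ?A = "slice v"
  define w where "w = (\<lambda>b. if b \<in> ?A then (cmod (f b))\<^sup>2 else 0)"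
  define M where "M = (\<Sum>y\<in>?A. (cmod (f y))\<^sup>2)"
  have AE: "?A \<subseteq> E" using slice_sub S_sub by blast
  have fin: "finite ?A" using AE finite_E finite_subset by blast
  have w0: "w b \<ge> 0" for b by (simp add: w_def)
  have ME: "(\<Sum>b\<in>E. w b) = M"
    using AE unfolding w_def M_def
    by (subst sum.inter_restrict[symmetric]) (auto simp: Int_absorb1)
  have MA: "(\<Sum>b\<in>?A. w b) = M" by (simp add: w_def M_def)
  have M0: "M \<ge> 0" by (simp add: M_def sum_nonneg)
  \<comment> \<open>Used for sums on the line of \<open>v\<close>: every coefficient of the convolution is at most the total mass.\<close>
  have on_line: "(cmod (conv ?A f m))\<^sup>2 \<le> M\<^sup>2" for m
  proof -
    have "cmod (conv ?A f m) \<le> (\<Sum>a\<in>?A. cmod (f a * (if red (m - a) \<in> ?A then f (red (m - a)) else 0)))"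
      unfolding conv_def by (rule norm_sum)
    also have "\<dots> \<le> (\<Sum>a\<in>?A. w a / 2 + w (red (m - a)) / 2)"
    proof (intro sum_mono)
      fix a assume a: "a \<in> ?A"
      have "cmod (f a) * cmod (f b) \<le> (cmod (f a))\<^sup>2 / 2 + (cmod (f b))\<^sup>2 / 2" for b
        using sum_squares_bound[of "cmod (f a)" "cmod (f b)"] by simp
      thus "cmod (f a * (if red (m - a) \<in> ?A then f (red (m - a)) else 0)) \<le> w a / 2 + w (red (m - a)) / 2"
        using a by (simp add: w_def norm_mult)
    qed
    also have "\<dots> = M / 2 + (\<Sum>a\<in>?A. w (red (m - a))) / 2"
      by (simp only: sum.distrib sum_divide_distrib[symmetric] MA)
    also have "(\<Sum>a\<in>?A. w (red (m - a))) \<le> (\<Sum>a\<in>E. w (red (m - a)))"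
      using AE w0 by (intro sum_mono2) auto
    also have "\<dots> = M" by (simp only: sum_reflect ME)
    finally have "cmod (conv ?A f m) \<le> M" by simp
    thus ?thesis by (intro power_mono) auto
  qed
  have off_line: "(cmod (conv ?A f m))\<^sup>2 \<le> 2 * real p * (\<Sum>a\<in>?A. w a * w (red (m - a)))"
    if m: "m \<notin> line v" "m \<in> E" for m
  proof (cases "int p dvd v \<cdot> m")
    case True
    let ?R = "{a \<in> ?A. red (m - a) \<in> ?A}"
    have "conv ?A f m = (\<Sum>a\<in>?R. f a * f (red (m - a)))"
      unfolding conv_def using fin by (subst sum.inter_filter) (auto intro!: sum.cong)
    hence "(cmod (conv ?A f m))\<^sup>2 \<le> (\<Sum>a\<in>?R. 1 * cmod (f a * f (red (m - a))))\<^sup>2"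
      by (intro power_mono) (auto intro: norm_sum)
    also have "\<dots> \<le> (\<Sum>a\<in>?R. 1\<^sup>2) * (\<Sum>a\<in>?R. (cmod (f a * f (red (m - a))))\<^sup>2)"
      by (rule Cauchy_Schwarz_ineq_sum)
    also have "\<dots> = real (card ?R) * (\<Sum>a\<in>?R. w a * w (red (m - a)))"
      by (simp add: w_def norm_mult power_mult_distrib)
    also have "\<dots> \<le> real (2 * p) * (\<Sum>a\<in>?A. w a * w (red (m - a)))"
      using card_slice_pairs[OF v True] m fin w0
      by (intro mult_mono sum_mono2 sum_nonneg mult_nonneg_nonneg of_nat_mono) (auto simp: line_def)
    finally show ?thesis by simp
  next
    case False
    have "red (m - a) \<notin> ?A" if "a \<in> ?A" for a
      using that False by (auto simp: slice_def dvd_dt_red dt_simps dvd_diff_left_iff)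
    hence "conv ?A f m = 0" unfolding conv_def by (intro sum.neutral) auto
    thus ?thesis using w0 by (simp add: sum_nonneg)
  qed
  have wshift: "(\<Sum>m\<in>E. w (red (m - a))) = M" for a
  proof -
    have "(\<Sum>m\<in>E. w (red (m - a))) = (\<Sum>m\<in>E. w (red (m + (- a))))" by simp
    also have "\<dots> = (\<Sum>m\<in>E. w (red m))"
      by (rule sum_shift) (simp add: red_eq_iff[symmetric])
    also have "\<dots> = M" using ME by (simp add: red_id)
    finally show ?thesis .
  qed
  have "(\<Sum>m\<in>E. (cmod (conv ?A f m))\<^sup>2)
     \<le> (\<Sum>m\<in>E. (if m \<in> line v then M\<^sup>2 else 0) + 2 * real p * (\<Sum>a\<in>?A. w a * w (red (m - a))))"
    using on_line off_line w0
    by (intro sum_mono) (auto intro!: order_trans[OF on_line] sum_nonneg mult_nonneg_nonneg)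
  also have "\<dots> = card (line v) * M\<^sup>2 + 2 * real p * (\<Sum>m\<in>E. \<Sum>a\<in>?A. w a * w (red (m - a)))"
    unfolding sum.distrib sum_distrib_left[symmetric]
    by (subst sum.inter_restrict[symmetric]) (auto simp: line_def Int_def)
  also have "(\<Sum>m\<in>E. \<Sum>a\<in>?A. w a * w (red (m - a))) = M\<^sup>2"
    by (subst sum.swap) (simp only: sum_distrib_left[symmetric] wshift sum_distrib_right[symmetric] MA power2_eq_square)
  also have "real (card (line v)) * M\<^sup>2 + 2 * real p * M\<^sup>2 \<le> 3 * real p * M\<^sup>2"
    using card_line[of v] mult_right_mono[of "real (card (line v))" "real p" "M\<^sup>2"] by simp
  finally have "real p ^ 4 * (\<Sum>m\<in>E. (cmod (conv ?A f m))\<^sup>2) \<le> real p ^ 4 * (3 * real p * M\<^sup>2)"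
    by (intro mult_left_mono) auto
  thus ?thesis
    unfolding fourth_moment[OF AE] M_def[symmetric]
    by (simp add: power4_eq_xxxx power_numeral_odd mult_ac numeral_eq_Suc)
qed

end

section \<open>The exceptional set\<close>

context finite_sphere
begin

definition isotropic :: "(int ^ 4) set" where
  "isotropic = {v \<in> E. \<not> v \<simeq> 0 \<and> int p dvd v \<cdot> v}"

lemma finite_isotropic [simp]: "finite isotropic" by (simp add: isotropic_def)

lemma indep_sphere:
  assumes y: "y \<in> S" and y': "y' \<in> S" and ne: "y' \<noteq> y" "y' \<noteq> red (- y)"
  shows "indep y y'"
proof (rule indepI)
  show "\<not> y \<simeq> 0"
    using S_nd[OF y] veq_dt[of y 0 y 0] by (auto simp: dt_simps cong_0_iff)
  fix c
  show "\<not> y' \<simeq> c *s y"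
  proof
    assume c: "y' \<simeq> c *s y"
    have "[y' \<cdot> y' = (c *s y) \<cdot> (c *s y)] (mod int p)" by (intro veq_dt c)
    moreover have "[y' \<cdot> y' = y \<cdot> y] (mod int p)"
      using y y' unfolding S_def by (metis (mono_tags, lifting) cong_sym cong_trans mem_Collect_eq)
    ultimately have "int p dvd (c *s y) \<cdot> (c *s y) - y \<cdot> y"
      by (metis cong_iff_dvd_diff cong_sym cong_trans)
    moreover have "(c *s y) \<cdot> (c *s y) - y \<cdot> y = (c - 1) * (c - (- 1)) * (y \<cdot> y)"
      by (simp add: dt_simps algebra_simps)
    ultimately have "int p dvd c - 1 \<or> int p dvd c - (- 1)"
      using S_nd[OF y] prime_int prime_dvd_mult_iff by metis
    hence "c *s y \<simeq> 1 *s y \<or> c *s y \<simeq> (- 1) *s y"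
      using veq_scale[OF _ veq_refl] by (metis cong_iff_dvd_diff)
    moreover have "1 *s y = y" "(- 1) *s y = - y" by (simp_all add: vec_eq_iff)
    ultimately have "y' \<simeq> y \<or> y' \<simeq> - y" using c veq_trans by metis
    hence "red y' = red y \<or> red y' = red (- y)" by (simp add: red_eq_iff)
    thus False using ne red_id S_sub y y' by (metis subsetD)
  qed
qed

text \<open>
  Expanding the square and exchanging sums, one counts the isotropic vectors orthogonal to two points
  \<open>y\<close> and \<open>y'\<close> of the sphere. There are \<open>O(p)\<close> of them, except that there may be \<open>O(p\<^sup>2)\<close> for
  \<open>y' = y\<close> and \<open>y' = - y\<close>; the pointwise bound on \<open>f\<close> makes up for these two cases.
\<close>

lemma slice_mass_sum:
  assumes f1: "(\<Sum>y\<in>S. (cmod (f y))\<^sup>2) \<le> 1" and flat: "\<And>y. y \<in> S \<Longrightarrow> (cmod (f y))\<^sup>2 \<le> 1 / real p"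
  shows "(\<Sum>v\<in>isotropic. (\<Sum>y\<in>slice v. (cmod (f y))\<^sup>2)\<^sup>2) \<le> 6 * real p"
proof -
  define w where "w = (\<lambda>y. (cmod (f y))\<^sup>2)"
  have w0: "w y \<ge> 0" for y by (simp add: w_def)
  have w1: "(\<Sum>y\<in>S. w y) \<le> 1" using f1 by (simp add: w_def)
  let ?c = "\<lambda>y y'. card {v \<in> isotropic. int p dvd y \<cdot> v \<and> int p dvd y' \<cdot> v}"
  let ?d = "\<lambda>y y'. 2 * real p + (if y' = y then 2 * real p ^ 2 else 0) + (if y' = red (- y) then 2 * real p ^ 2 else 0)"
  have "(\<Sum>y\<in>slice v. w y)\<^sup>2 = (\<Sum>y\<in>S. \<Sum>y'\<in>S. if int p dvd y \<cdot> v \<and> int p dvd y' \<cdot> v then w y * w y' else 0)" for v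
  proof -
    have "(\<Sum>y\<in>slice v. w y) = (\<Sum>y\<in>S. if int p dvd y \<cdot> v then w y else 0)"
      unfolding slice_def by (simp add: sum.inter_filter dt_commute)
    thus ?thesis unfolding power2_eq_square by (simp only: sum_product) (intro sum.cong refl, auto)
  qed
  hence "(\<Sum>v\<in>isotropic. (\<Sum>y\<in>slice v. w y)\<^sup>2)
      = (\<Sum>v\<in>isotropic. \<Sum>y\<in>S. \<Sum>y'\<in>S. if int p dvd y \<cdot> v \<and> int p dvd y' \<cdot> v then w y * w y' else 0)"
    by simp
  also have "\<dots> = (\<Sum>y\<in>S. \<Sum>y'\<in>S. \<Sum>v\<in>isotropic. if int p dvd y \<cdot> v \<and> int p dvd y' \<cdot> v then w y * w y' else 0)"
    by (rule sum_rotate)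
  also have "\<dots> = (\<Sum>y\<in>S. \<Sum>y'\<in>S. w y * w y' * real (?c y y'))"
    by (simp add: sum.inter_filter[symmetric] mult.commute)
  also have "\<dots> \<le> (\<Sum>y\<in>S. \<Sum>y'\<in>S. w y * w y' * ?d y y')"
  proof (intro sum_mono mult_left_mono mult_nonneg_nonneg w0)
    fix y y' assume y: "y \<in> S" and y': "y' \<in> S"
    have "?c y y' \<le> card {v \<in> E. int p dvd v \<cdot> v \<and> int p dvd y \<cdot> v}"
      by (intro card_mono) (auto simp: isotropic_def)
    hence 1: "?c y y' \<le> 2 * p ^ 2" using card_iso_perp[OF S_nd[OF y]] by linarith
    have 2: "?c y y' \<le> 2 * p" if "y' \<noteq> y" "y' \<noteq> red (- y)"
    proof -
      have "?c y y' \<le> card {v \<in> E. int p dvd v \<cdot> v \<and> int p dvd y \<cdot> v \<and> int p dvd y' \<cdot> v}"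
        by (intro card_mono) (auto simp: isotropic_def)
      thus ?thesis using card_iso_pair[OF indep_sphere[OF y y' that] S_nd[OF y]] by linarith
    qed
    have "real (?c y y') \<le> 2 * real p ^ 2" "y' \<noteq> y \<Longrightarrow> y' \<noteq> red (- y) \<Longrightarrow> real (?c y y') \<le> 2 * real p"
      using of_nat_mono[OF 1, where 'a = real] of_nat_mono[OF 2, where 'a = real] by simp_all
    thus "real (?c y y') \<le> ?d y y'" by auto
  qed
  also have "\<dots> \<le> (\<Sum>y\<in>S. w y * (6 * real p))"
  proof (intro sum_mono)
    fix y assume y: "y \<in> S"
    have wp: "w z * (2 * real p ^ 2) \<le> 2 * real p" if "z \<in> S" for z
    proof -
      have "w z * (2 * real p ^ 2) \<le> 1 / real p * (2 * real p ^ 2)"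
        using flat[OF that] by (intro mult_right_mono) (auto simp: w_def)
      also have "\<dots> = 2 * real p" by (simp add: power2_eq_square)
      finally show ?thesis .
    qed
    have "(\<Sum>y'\<in>S. w y' * ?d y y') = (\<Sum>y'\<in>S. w y') * (2 * real p)
        + (\<Sum>y'\<in>S. if y' = y then w y' * (2 * real p ^ 2) else 0)
        + (\<Sum>y'\<in>S. if y' = red (- y) then w y' * (2 * real p ^ 2) else 0)"
      unfolding sum_distrib_right sum.distrib[symmetric]
      by (intro sum.cong refl) (simp add: distrib_left if_distrib[of "(*) (w _)"] del: mult_cancel_left cong: if_cong)
    also have "\<dots> \<le> 1 * (2 * real p) + 2 * real p + 2 * real p"
    proof (intro add_mono)
      show "(\<Sum>y'\<in>S. w y') * (2 * real p) \<le> 1 * (2 * real p)" using w1 by (intro mult_right_mono) auto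
      show "(\<Sum>y'\<in>S. if y' = y then w y' * (2 * real p ^ 2) else 0) \<le> 2 * real p"
        using wp[OF y] by (subst sum.delta) auto
      show "(\<Sum>y'\<in>S. if y' = red (- y) then w y' * (2 * real p ^ 2) else 0) \<le> 2 * real p"
        using wp[of "red (- y)"] by (subst sum.delta) auto
    qed
    finally have "w y * (\<Sum>y'\<in>S. w y' * ?d y y') \<le> w y * (6 * real p)"
      using w0 by (intro mult_left_mono) auto
    thus "(\<Sum>y'\<in>S. w y * w y' * ?d y y') \<le> w y * (6 * real p)"
      by (simp only: sum_distrib_left mult.assoc)
  qed
  also have "\<dots> = (\<Sum>y\<in>S. w y) * (6 * real p)" by (simp only: sum_distrib_right)
  also have "\<dots> \<le> 1 * (6 * real p)" using w1 by (intro mult_right_mono) auto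
  finally show ?thesis unfolding w_def by linarith
qed

text \<open>
  The points at which the extension of some isotropic section alone is a sizeable part of the level
  \<open>L\<close>. Away from them, isotropic hyperplanes are as poor in points of the level set as all others.
\<close>

definition exceptional :: "(int ^ 4 \<Rightarrow> complex) \<Rightarrow> real \<Rightarrow> (int ^ 4) set" where
  "exceptional f L = {x \<in> E. \<exists>v\<in>isotropic. cmod (hat (slice v) f x) > L / 2}"

lemma slice_scale: "\<not> int p dvd c \<Longrightarrow> slice (red (c *s v)) = slice v"
  unfolding slice_def dvd_dt_red dt_simps using prime_int by (auto simp: prime_dvd_mult_iff)

text \<open>
  Chebyshev's inequality with \<open>slice_l4\<close>, summed over isotropic \<open>v\<close>. The \<open>p - 1\<close> multiples of \<open>v\<close>
  define the same section, so every exceptional point is counted at least \<open>p - 1\<close> times, which saves a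
  factor \<open>p\<close>.
\<close>

lemma card_exceptional:
  assumes f1: "(\<Sum>y\<in>S. (cmod (f y))\<^sup>2) \<le> 1" and flat: "\<And>y. y \<in> S \<Longrightarrow> (cmod (f y))\<^sup>2 \<le> 1 / real p"
    and L: "L > 0"
  shows "real (card (exceptional f L)) * L ^ 4 \<le> 576 * real p ^ 5"
proof -
  let ?B = "exceptional f L"
  let ?u = "\<lambda>v x. (cmod (hat (slice v) f x)) ^ 4"
  have fin: "finite ?B" by (simp add: exceptional_def)
  \<comment> \<open>The \<open>p - 1\<close> nonzero multiples of one bad isotropic vector all witness the same exceptional point.\<close>
  have low: "real (p - 1) * (L / 2) ^ 4 \<le> (\<Sum>v\<in>isotropic. ?u v x)" if x: "x \<in> ?B" for x
  proof -
    obtain v where v: "v \<in> isotropic" "cmod (hat (slice v) f x) > L / 2"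
      using x unfolding exceptional_def by blast
    have nz: "\<not> v \<simeq> 0" using v by (simp add: isotropic_def)
    let ?h = "\<lambda>c. red (c *s v)"
    have inj: "inj_on ?h {1..<int p}"
    proof (rule inj_onI)
      fix c d assume cd: "c \<in> {1..<int p}" "d \<in> {1..<int p}" "?h c = ?h d"
      hence "c *s v - d *s v \<simeq> 0" by (simp add: red_eq_iff veq_diff_zero[symmetric])
      moreover have "c *s v - d *s v = (c - d) *s v" by (simp add: vec_eq_iff algebra_simps)
      ultimately have "int p dvd c - d" using nz veq_zero_scale by metis
      thus "c = d" using cd F_eqI by (metis F_split insertCI)
    qed
    have sub: "?h ` {1..<int p} \<subseteq> isotropic"
    proof clarify
      fix c assume c: "c \<in> {1..<int p}"
      have "\<not> red (c *s v) \<simeq> 0"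
        using nz nd_F[OF c] veq_zero_scale red_veq veq_sym veq_trans by metis
      moreover have "int p dvd red (c *s v) \<cdot> red (c *s v)"
        using v by (simp add: dvd_dt_red dt_simps isotropic_def)
      ultimately show "?h c \<in> isotropic" by (simp add: isotropic_def)
    qed
    have "real (p - 1) * (L / 2) ^ 4 \<le> (\<Sum>c\<in>{1..<int p}. ?u v x)"
      using v L p_pos by (simp add: of_nat_diff) (intro mult_left_mono power_mono, auto)
    also have "\<dots> = (\<Sum>c\<in>{1..<int p}. ?u (?h c) x)"
      by (intro sum.cong refl) (simp only: slice_scale[OF nd_F])
    also have "\<dots> = (\<Sum>v\<in>?h ` {1..<int p}. ?u v x)"
      by (simp add: sum.reindex[OF inj])
    also have "\<dots> \<le> (\<Sum>v\<in>isotropic. ?u v x)"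
      using sub by (intro sum_mono2) auto
    finally show ?thesis .
  qed
  have "real (card ?B) * (real (p - 1) * (L / 2) ^ 4) = (\<Sum>x\<in>?B. real (p - 1) * (L / 2) ^ 4)"
    by simp
  also have "\<dots> \<le> (\<Sum>x\<in>?B. \<Sum>v\<in>isotropic. ?u v x)"
    using low by (intro sum_mono)
  also have "\<dots> \<le> (\<Sum>x\<in>E. \<Sum>v\<in>isotropic. ?u v x)"
    by (intro sum_mono2) (auto simp: exceptional_def sum_nonneg)
  also have "\<dots> = (\<Sum>v\<in>isotropic. \<Sum>x\<in>E. ?u v x)" by (rule sum.swap)
  also have "\<dots> \<le> (\<Sum>v\<in>isotropic. 3 * real p ^ 5 * (\<Sum>y\<in>slice v. (cmod (f y))\<^sup>2)\<^sup>2)"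
    by (intro sum_mono slice_l4) (auto simp: isotropic_def)
  also have "\<dots> = 3 * real p ^ 5 * (\<Sum>v\<in>isotropic. (\<Sum>y\<in>slice v. (cmod (f y))\<^sup>2)\<^sup>2)"
    by (simp only: sum_distrib_left)
  also have "\<dots> \<le> 3 * real p ^ 5 * (6 * real p)"
    by (intro mult_left_mono slice_mass_sum f1 flat) auto
  finally have main: "real (card ?B) * (real (p - 1) * (L / 2) ^ 4) \<le> 18 * real p ^ 6"
    by (simp add: numeral_eq_Suc)
  have "real p / 2 \<le> real (p - 1)" using p_ge_3 by (simp add: of_nat_diff)
  hence "real (card ?B) * (real p / 2 * (L / 2) ^ 4) \<le> real (card ?B) * (real (p - 1) * (L / 2) ^ 4)"
    using L by (intro mult_left_mono mult_right_mono) auto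
  with main have "real (card ?B) * (real p / 2 * (L / 2) ^ 4) \<le> 18 * real p ^ 6" by linarith
  hence "real p * (real (card ?B) * L ^ 4) \<le> real p * (576 * real p ^ 5)"
    by (simp add: power_divide mult_ac numeral_eq_Suc)
  thus ?thesis using p_pos by (simp add: mult_le_cancel_left)
qed

text \<open>
  A line meets a quadric in at most two points unless it is contained in it. A line in direction \<open>v\<close>
  through \<open>y\<close> can be contained in the sphere only if \<open>v\<close> is isotropic and orthogonal to \<open>y\<close>.
\<close>

lemma secant_degree:
  assumes v: "\<not> v \<simeq> 0"
    and A: "A \<subseteq> S" "\<And>y. y \<in> A \<Longrightarrow> int p dvd v \<cdot> v \<Longrightarrow> \<not> int p dvd v \<cdot> y"
    and y: "y \<in> A"
  shows "card {y' \<in> A. \<exists>c. y - y' \<simeq> c *s v} \<le> 2"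
proof -
  let ?D = "{y' \<in> A. \<exists>c. y - y' \<simeq> c *s v}"
  have fin: "finite ?D" using finite_subset[OF A(1) finite_S] by simp
  have key: "int p dvd c * (v \<cdot> v) - 2 * (v \<cdot> y)" if "y' \<in> ?D" "y' \<noteq> y" "y - y' \<simeq> c *s v" for y' c
  proof -
    have "y - (y - y') \<simeq> y - c *s v" by (intro veq_diff that veq_refl)
    hence yc: "y' \<simeq> y - c *s v" by simp
    have nc: "\<not> int p dvd c"
    proof
      assume "int p dvd c"
      hence "c *s v \<simeq> 0" by (simp add: veq_zero_scale)
      hence "y \<simeq> y'" using that(3) veq_trans veq_diff_zero by blast
      thus False using that y A(1) S_sub veq_E by (metis (no_types, lifting) mem_Collect_eq subsetD)
    qed
    have "[y' \<cdot> y' = (y - c *s v) \<cdot> (y - c *s v)] (mod int p)" by (intro veq_dt yc)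
    moreover have "[y' \<cdot> y' = y \<cdot> y] (mod int p)"
      using y that(1) A(1) unfolding S_def by (metis (mono_tags, lifting) cong_sym cong_trans mem_Collect_eq subsetD)
    ultimately have "int p dvd (y - c *s v) \<cdot> (y - c *s v) - y \<cdot> y"
      by (metis cong_iff_dvd_diff cong_sym cong_trans)
    moreover have "(y - c *s v) \<cdot> (y - c *s v) - y \<cdot> y = c * (c * (v \<cdot> v) - 2 * (v \<cdot> y))"
      by (simp add: dt_simps dt_commute[of y v] algebra_simps)
    ultimately show ?thesis using nc prime_int prime_dvd_mult_iff by metis
  qed
  have uniq: "a = b" if ab: "a \<in> ?D - {y}" "b \<in> ?D - {y}" for a b
  proof -
    obtain c d where cd: "y - a \<simeq> c *s v" "y - b \<simeq> d *s v" using ab by auto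
    have kc: "int p dvd c * (v \<cdot> v) - 2 * (v \<cdot> y)" using ab cd(1) by (intro key[of a]) auto
    have kd: "int p dvd d * (v \<cdot> v) - 2 * (v \<cdot> y)" using ab cd(2) by (intro key[of b]) auto
    have "int p dvd (c * (v \<cdot> v) - 2 * (v \<cdot> y)) - (d * (v \<cdot> v) - 2 * (v \<cdot> y))"
      using kc kd by (rule dvd_diff)
    hence "int p dvd (c - d) * (v \<cdot> v)" by (simp add: algebra_simps)
    moreover have "\<not> int p dvd v \<cdot> v"
    proof
      assume vv: "int p dvd v \<cdot> v"
      hence "int p dvd 2 * (v \<cdot> y)" using kc by (simp add: dvd_diff_right_iff)
      thus False using A(2)[OF y vv] not_dvd_2 by blast
    qed
    ultimately have "int p dvd c - d" using prime_int prime_dvd_mult_iff by blast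
    hence "c *s v \<simeq> d *s v" by (intro veq_scale veq_refl) (simp add: cong_iff_dvd_diff)
    hence "y - a \<simeq> y - b" using cd veq_trans veq_sym by meson
    from veq_diff[OF veq_refl[of y] this] have "a \<simeq> b" by simp
    thus "a = b" using ab A(1) S_sub veq_E by (metis (no_types, lifting) DiffD1 mem_Collect_eq subsetD)
  qed
  have "card (?D - {y}) \<le> Suc 0"
    unfolding card_le_Suc0_iff_eq[OF finite_Diff[OF fin]] by (intro ballI uniq)
  moreover have "card ?D \<le> card (insert y (?D - {y}))"
    using fin by (intro card_mono) auto
  moreover have "card (insert y (?D - {y})) \<le> Suc (card (?D - {y}))"
    using card_Un_le[of "{y}" "?D - {y}"] by (simp only: insert_is_Un[symmetric] card.insert card.empty finite.emptyI empty_iff not_False_eq_True plus_1_eq_Suc)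
  ultimately show ?thesis by linarith
qed

text \<open>
  For isotropic \<open>v\<close> the section orthogonal to \<open>v\<close> is first discarded. Outside the exceptional set the
  rest of \<open>f\<close> still has an extension larger than \<open>L / 2\<close>, and \<open>hyperplane_l2\<close> applies to it.
\<close>

lemma card_level_hyperplane:
  assumes f1: "(\<Sum>y\<in>S. (cmod (f y))\<^sup>2) \<le> 1" and L: "L > 0" and v: "\<not> v \<simeq> 0"
    and G: "\<And>x. x \<in> G \<Longrightarrow> x \<in> E \<and> cmod (hat S f x) > L \<and> x \<notin> exceptional f L"
  shows "real (card (G \<inter> hyperplane v b)) * L\<^sup>2 \<le> 8 * real p ^ 3"
proof -
  \<comment> \<open>The part of the sphere that carries no line in direction \<open>v\<close>.\<close>
  define A where "A = (if int p dvd v \<cdot> v then S - slice v else S)"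
  have AS: "A \<subseteq> S" by (auto simp: A_def)
  have big: "cmod (hat A f x) > L / 2" if x: "x \<in> G" for x
  proof (cases "int p dvd v \<cdot> v")
    case True
    have "\<not> red v \<simeq> 0" using v veq_trans[OF veq_sym[OF red_veq[of v]]] by blast
    hence "red v \<in> isotropic" using True by (simp add: isotropic_def dvd_dt_red)
    moreover have "slice (red v) = slice v" by (simp add: slice_def dvd_dt_red)
    ultimately have "cmod (hat (slice v) f x) \<le> L / 2"
      using G[OF x] by (force simp: exceptional_def)
    moreover have "hat S f x = hat A f x + hat (slice v) f x"
      unfolding hat_def A_def using True slice_sub by (simp add: sum.subset_diff[of "slice v" S])
    ultimately show ?thesis using G[OF x] norm_triangle_ineq[of "hat A f x" "hat (slice v) f x"] by simp
  next
    case False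
    thus ?thesis using G[OF x] L by (simp add: A_def)
  qed
  have "real (card (G \<inter> hyperplane v b)) * (L / 2)\<^sup>2 = (\<Sum>x\<in>G \<inter> hyperplane v b. (L / 2)\<^sup>2)" by simp
  also have "\<dots> \<le> (\<Sum>x\<in>G \<inter> hyperplane v b. (cmod (hat A f x))\<^sup>2)"
    using big L by (intro sum_mono power_mono) (auto intro: less_imp_le)
  also have "\<dots> \<le> (\<Sum>x\<in>hyperplane v b. (cmod (hat A f x))\<^sup>2)"
    by (intro sum_mono2) (auto simp: hyperplane_def)
  also have "\<dots> \<le> 2 * real p ^ 3 * (\<Sum>y\<in>A. (cmod (f y))\<^sup>2)"
  proof (rule hyperplane_l2)
    show "A \<subseteq> E" using AS S_sub by blast
    fix y assume "y \<in> A"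
    thus "card {y' \<in> A. \<exists>c. y - y' \<simeq> c *s v} \<le> 2"
      by (intro secant_degree v AS) (auto simp: A_def slice_def split: if_splits)
  qed (rule v)
  also have "\<dots> \<le> 2 * real p ^ 3 * 1"
    using AS f1 by (intro mult_left_mono order_trans[OF sum_mono2[OF finite_S AS]]) auto
  finally show ?thesis by (simp add: power_divide field_simps)
qed

end

section \<open>Fourth moments and point-hyperplane incidences\<close>

lemma sum_times: "(\<Sum>q\<in>A \<times> B. h q) = (\<Sum>x\<in>A. \<Sum>y\<in>B. h (x, y))"
  by (simp add: sum.cartesian_product)

lemma sum_power4:
  fixes h :: "'a \<Rightarrow> real"
  shows "(\<Sum>x\<in>A. h x) ^ 4 \<le> real (card A) ^ 3 * (\<Sum>x\<in>A. (h x) ^ 4)"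
proof -
  have cs: "(\<Sum>x\<in>A. k x)\<^sup>2 \<le> real (card A) * (\<Sum>x\<in>A. (k x)\<^sup>2)" for k :: "'a \<Rightarrow> real"
    using Cauchy_Schwarz_ineq_sum[of "\<lambda>_. 1" k A] by simp
  have "(\<Sum>x\<in>A. h x) ^ 4 = ((\<Sum>x\<in>A. h x)\<^sup>2)\<^sup>2" by simp
  also have "\<dots> \<le> (real (card A) * (\<Sum>x\<in>A. (h x)\<^sup>2))\<^sup>2"
    by (intro power_mono cs) auto
  also have "\<dots> = real (card A) ^ 2 * (\<Sum>x\<in>A. (h x)\<^sup>2)\<^sup>2" by (rule power_mult_distrib)
  also have "\<dots> \<le> real (card A) ^ 2 * (real (card A) * (\<Sum>x\<in>A. ((h x)\<^sup>2)\<^sup>2))"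
    by (intro mult_left_mono cs) auto
  also have "\<dots> = real (card A) ^ 3 * (\<Sum>x\<in>A. (h x) ^ 4)"
    by (simp add: power2_eq_square[of "real (card A)"] power3_eq_cube)
  finally show ?thesis .
qed

text \<open>
  In the expanded square the products \<open>c i * cnj (c k)\<close> are multiplied by nonnegative correlations, so
  the triangle inequality is an equality for constant coefficients.
\<close>

lemma majorant_l2:
  fixes c :: "'i \<Rightarrow> complex" and \<theta> :: "'i \<Rightarrow> 'z \<Rightarrow> complex"
  assumes c: "\<And>i. i \<in> I \<Longrightarrow> cmod (c i) \<le> K" and K: "K \<ge> 0"
    and pos: "\<And>i k. i \<in> I \<Longrightarrow> k \<in> I \<Longrightarrow> \<exists>r\<ge>0. (\<Sum>z\<in>Z. \<theta> i z * cnj (\<theta> k z)) = complex_of_real r"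
  shows "(\<Sum>z\<in>Z. (cmod (\<Sum>i\<in>I. c i * \<theta> i z))\<^sup>2) \<le> K\<^sup>2 * (\<Sum>z\<in>Z. (cmod (\<Sum>i\<in>I. \<theta> i z))\<^sup>2)"
proof -
  define D where "D = (\<lambda>i k. \<Sum>z\<in>Z. \<theta> i z * cnj (\<theta> k z))"
  have expand: "complex_of_real (\<Sum>z\<in>Z. (cmod (\<Sum>i\<in>I. b i * \<theta> i z))\<^sup>2)
      = (\<Sum>i\<in>I. \<Sum>k\<in>I. b i * cnj (b k) * D i k)" for b :: "'i \<Rightarrow> complex"
  proof -
    have "complex_of_real (\<Sum>z\<in>Z. (cmod (\<Sum>i\<in>I. b i * \<theta> i z))\<^sup>2)
        = (\<Sum>z\<in>Z. \<Sum>i\<in>I. \<Sum>k\<in>I. b i * cnj (b k) * (\<theta> i z * cnj (\<theta> k z)))"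
      by (simp only: of_real_sum complex_norm_square cnj_sum sum_product complex_cnj_mult mult_ac)
    also have "\<dots> = (\<Sum>i\<in>I. \<Sum>k\<in>I. b i * cnj (b k) * D i k)"
      unfolding D_def sum_distrib_left by (rule sum_rotate)
    finally show ?thesis .
  qed
  have "(\<Sum>z\<in>Z. (cmod (\<Sum>i\<in>I. c i * \<theta> i z))\<^sup>2) \<le> cmod (complex_of_real (\<Sum>z\<in>Z. (cmod (\<Sum>i\<in>I. c i * \<theta> i z))\<^sup>2))"
    unfolding norm_of_real by (rule abs_ge_self)
  also have "\<dots> \<le> (\<Sum>i\<in>I. \<Sum>k\<in>I. cmod (c i * cnj (c k) * D i k))"
    unfolding expand by (intro order_trans[OF norm_sum] sum_mono norm_sum)
  also have "\<dots> \<le> (\<Sum>i\<in>I. \<Sum>k\<in>I. K\<^sup>2 * Re (D i k))"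
  proof (intro sum_mono)
    fix i k assume ik: "i \<in> I" "k \<in> I"
    obtain r where r: "r \<ge> 0" "D i k = complex_of_real r" using pos[OF ik] by (auto simp: D_def)
    have "cmod (c i) * cmod (c k) * r \<le> K * K * r"
      using c[OF ik(1)] c[OF ik(2)] K r(1) by (intro mult_right_mono mult_mono) auto
    thus "cmod (c i * cnj (c k) * D i k) \<le> K\<^sup>2 * Re (D i k)"
      using r by (simp add: norm_mult power2_eq_square)
  qed
  also have "\<dots> = K\<^sup>2 * Re (\<Sum>i\<in>I. \<Sum>k\<in>I. 1 * cnj 1 * D i k)"
    by (simp add: sum_distrib_left)
  also have "\<dots> = K\<^sup>2 * (\<Sum>z\<in>Z. (cmod (\<Sum>i\<in>I. \<theta> i z))\<^sup>2)"
    by (subst expand[of "\<lambda>_. 1", symmetric]) simp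
  finally show ?thesis .
qed

lemma majorant_l4:
  fixes c :: "'i \<Rightarrow> complex" and \<theta> :: "'i \<Rightarrow> 'z \<Rightarrow> complex"
  assumes c: "\<And>i. i \<in> I \<Longrightarrow> cmod (c i) \<le> K" and K: "K \<ge> 0"
    and pos: "\<And>i k i' k'. i \<in> I \<Longrightarrow> k \<in> I \<Longrightarrow> i' \<in> I \<Longrightarrow> k' \<in> I \<Longrightarrow>
      \<exists>r\<ge>0. (\<Sum>z\<in>Z. \<theta> i z * \<theta> k z * cnj (\<theta> i' z * \<theta> k' z)) = complex_of_real r"
  shows "(\<Sum>z\<in>Z. (cmod (\<Sum>i\<in>I. c i * \<theta> i z)) ^ 4) \<le> K ^ 4 * (\<Sum>z\<in>Z. (cmod (\<Sum>i\<in>I. \<theta> i z)) ^ 4)"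
proof -
  have sq: "(cmod (\<Sum>i\<in>I. b i * \<theta> i z)) ^ 4
      = (cmod (\<Sum>q\<in>I \<times> I. (b (fst q) * b (snd q)) * (\<theta> (fst q) z * \<theta> (snd q) z)))\<^sup>2" for b z
  proof -
    have "(\<Sum>q\<in>I \<times> I. (b (fst q) * b (snd q)) * (\<theta> (fst q) z * \<theta> (snd q) z)) = (\<Sum>i\<in>I. b i * \<theta> i z)\<^sup>2"
      by (simp add: sum_product power2_eq_square sum_times mult_ac)
    thus ?thesis by (simp add: norm_power)
  qed
  have "(\<Sum>z\<in>Z. (cmod (\<Sum>i\<in>I. c i * \<theta> i z)) ^ 4)
      \<le> (K\<^sup>2)\<^sup>2 * (\<Sum>z\<in>Z. (cmod (\<Sum>q\<in>I \<times> I. \<theta> (fst q) z * \<theta> (snd q) z))\<^sup>2)"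
    unfolding sq
  proof (rule majorant_l2)
    fix q assume "q \<in> I \<times> I"
    thus "cmod (c (fst q) * c (snd q)) \<le> K\<^sup>2"
      using c K by (auto simp: norm_mult power2_eq_square intro!: mult_mono)
  next
    fix q q' assume "q \<in> I \<times> I" "q' \<in> I \<times> I"
    thus "\<exists>r\<ge>0. (\<Sum>z\<in>Z. \<theta> (fst q) z * \<theta> (snd q) z * cnj (\<theta> (fst q') z * \<theta> (snd q') z)) = complex_of_real r"
      by (intro pos) auto
  qed simp
  thus ?thesis using sq[of "\<lambda>_. 1"] by simp
qed

context odd_prime
begin

abbreviation "F1 \<equiv> {1..<int p}"

text \<open>
  The factor \<open>2\<close> comes from \<open>Q (y - x) = Q y - 2 * (x \<cdot> y) + Q x\<close>: incidences of this form are what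
  the linear part of the Gaussian kernels counts.
\<close>

definition incidence :: "(int ^ 4) set \<Rightarrow> int ^ 4 \<Rightarrow> int \<Rightarrow> real" where
  "incidence G x \<tau> = real (card (G \<inter> hyperplane (2 *s x) \<tau>))"

lemma sum_phase:
  assumes G: "G \<subseteq> E"
  shows "(\<Sum>i\<in>F1 \<times> G. e (fst i * (\<tau> - 2 * (snd i \<cdot> x)))) = of_real (real p * incidence G x \<tau> - real (card G))"
proof -
  have fin: "finite G" using G finite_E finite_subset by blast
  have "(\<Sum>i\<in>F1 \<times> G. e (fst i * (\<tau> - 2 * (snd i \<cdot> x)))) = (\<Sum>y\<in>G. \<Sum>k\<in>F1. e (k * (\<tau> - 2 * (y \<cdot> x))))"
    by (simp add: sum_times) (rule sum.swap)
  also have "\<dots> = (\<Sum>y\<in>G. (if y \<in> hyperplane (2 *s x) \<tau> then of_nat p else 0) - 1)"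
  proof (rule sum.cong[OF refl])
    fix y assume "y \<in> G"
    hence "int p dvd \<tau> - 2 * (y \<cdot> x) \<longleftrightarrow> y \<in> hyperplane (2 *s x) \<tau>"
      using G by (auto simp: hyperplane_def dt_simps dt_commute[of x y] dvd_diff_commute)
    moreover have "(\<Sum>k\<in>F. e (k * (\<tau> - 2 * (y \<cdot> x)))) = 1 + (\<Sum>k\<in>F1. e (k * (\<tau> - 2 * (y \<cdot> x))))"
      by (subst sum_F_split) simp
    ultimately show "(\<Sum>k\<in>F1. e (k * (\<tau> - 2 * (y \<cdot> x)))) = (if y \<in> hyperplane (2 *s x) \<tau> then of_nat p else 0) - 1"
      by (simp add: chi_orth_F)
  qed
  also have "\<dots> = of_real (real p * incidence G x \<tau> - real (card G))"
    using fin by (simp add: sum_subtractf sum.inter_restrict[symmetric] incidence_def)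
  finally show ?thesis .
qed

lemma phase_orth:
  "(\<Sum>z\<in>E \<times> F. e (a * snd z + w \<cdot> fst z)) = (if int p dvd a \<and> w \<simeq> 0 then of_nat (p ^ 5) else 0)"
proof -
  have "(\<Sum>z\<in>E \<times> F. e (a * snd z + w \<cdot> fst z)) = (\<Sum>x\<in>E. e (w \<cdot> x)) * (\<Sum>t\<in>F. e (t * a))"
    by (simp add: sum_times chi_add sum_product mult.commute)
  thus ?thesis by (simp add: chi_orth_E chi_orth_F numeral_eq_Suc)
qed

text \<open>
  By \<open>sum_phase\<close> the deviation from the mean is a sum of \<open>(p - 1) * |G|\<close> characters of the group
  \<open>F_p^5\<close>. These are pairwise different, so the mean square has only diagonal terms.
\<close>

lemma incidence_variance:
  assumes G: "G \<subseteq> E"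
  shows "(\<Sum>z\<in>E \<times> F. (real p * incidence G (fst z) (snd z) - real (card G))\<^sup>2) \<le> real p ^ 6 * real (card G)"
proof -
  have fin: "finite G" using G finite_E finite_subset by blast
  let ?I = "F1 \<times> G"
  let ?\<theta> = "\<lambda>i z. e (fst i * (snd z - 2 * (snd i \<cdot> fst z)))"
  have eq: "?\<theta> i z * cnj (?\<theta> k z) = e ((fst i - fst k) * snd z + ((- 2 * fst i) *s snd i + (2 * fst k) *s snd k) \<cdot> fst z)" for i k z
    by (simp add: cnj_chi chi_add[symmetric] dt_simps algebra_simps)
  have orth: "(\<Sum>z\<in>E \<times> F. ?\<theta> i z * cnj (?\<theta> k z)) = (if k = i then of_nat (p ^ 5) else 0)"
    if ik: "i \<in> ?I" "k \<in> ?I" for i k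
  proof -
    have "int p dvd (fst i - fst k) \<and> (- 2 * fst i) *s snd i + (2 * fst k) *s snd k \<simeq> 0 \<longleftrightarrow> k = i"
    proof
      assume A: "int p dvd (fst i - fst k) \<and> (- 2 * fst i) *s snd i + (2 * fst k) *s snd k \<simeq> 0"
      have ki: "fst i = fst k" using A ik F_eqI by (auto simp: F_split)
      have "(- 2 * fst i) *s snd i + (2 * fst k) *s snd k = (2 * fst i) *s (snd k - snd i)"
        by (simp add: ki vec_eq_iff algebra_simps)
      hence "snd k - snd i \<simeq> 0"
        using A ik not_dvd_2 nd_F veq_zero_scale by (metis mem_Times_iff)
      hence "snd k = snd i" using ik G veq_E veq_diff_zero by (metis mem_Times_iff subsetD)
      with ki show "k = i" by (simp add: prod_eq_iff)
    next
      assume "k = i"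
      moreover have "(- 2 * fst i) *s snd i + (2 * fst i) *s snd i = 0" by (simp add: vec_eq_iff)
      ultimately show "int p dvd (fst i - fst k) \<and> (- 2 * fst i) *s snd i + (2 * fst k) *s snd k \<simeq> 0"
        by simp
    qed
    thus ?thesis unfolding eq phase_orth by simp
  qed
  have "complex_of_real (\<Sum>z\<in>E \<times> F. (real p * incidence G (fst z) (snd z) - real (card G))\<^sup>2)
      = (\<Sum>z\<in>E \<times> F. complex_of_real ((cmod (\<Sum>i\<in>?I. ?\<theta> i z))\<^sup>2))"
    unfolding sum_phase[OF G] norm_of_real by simp
  also have "\<dots> = (\<Sum>z\<in>E \<times> F. \<Sum>i\<in>?I. \<Sum>k\<in>?I. ?\<theta> i z * cnj (?\<theta> k z))"
    unfolding complex_norm_square cnj_sum sum_product ..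
  also have "\<dots> = (\<Sum>i\<in>?I. \<Sum>k\<in>?I. \<Sum>z\<in>E \<times> F. ?\<theta> i z * cnj (?\<theta> k z))"
    by (rule sum_rotate)
  also have "\<dots> = (\<Sum>i\<in>?I. \<Sum>k\<in>?I. if k = i then of_nat (p ^ 5) else 0)"
    by (intro sum.cong refl orth)
  also have "\<dots> = complex_of_real (real (card ?I * p ^ 5))"
    using fin by (simp add: sum.delta)
  finally have "(\<Sum>z\<in>E \<times> F. (real p * incidence G (fst z) (snd z) - real (card G))\<^sup>2) = real (card ?I * p ^ 5)"
    by (simp only: of_real_eq_iff)
  also have "card ?I * p ^ 5 \<le> p * card G * p ^ 5"
    by (simp add: card_cartesian_product nat_le_iff)
  hence "real (card ?I * p ^ 5) \<le> real (p * card G * p ^ 5)" by (rule of_nat_mono)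
  finally show ?thesis by (simp add: numeral_eq_Suc mult_ac)
qed

text \<open>
  The variable \<open>x = 0\<close> does not define a hyperplane and produces the first term. For \<open>x \<noteq> 0\<close> two of
  the four factors are bounded uniformly and the other two are summed by \<open>incidence_variance\<close>.
\<close>

lemma incidence_l4:
  assumes G: "G \<subseteq> E" and R: "\<And>v b. \<not> v \<simeq> 0 \<Longrightarrow> real (card (G \<inter> hyperplane v b)) \<le> R"
  shows "(\<Sum>z\<in>E \<times> F. (real p * incidence G (fst z) (snd z) - real (card G)) ^ 4)
    \<le> 2 * real p ^ 4 * real (card G) ^ 4 + (real p * R + real (card G))\<^sup>2 * (real p ^ 6 * real (card G))"
proof -
  have fin: "finite G" using G finite_E finite_subset by blast
  define N where "N = real (card G)"
  let ?d = "\<lambda>z. real p * incidence G (fst z) (snd z) - N"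
  have zero: "0 \<in> E" using p_pos by (simp add: E_eq)
  have R0: "R \<ge> 0"
  proof -
    have "\<not> (\<chi> i. 1) \<simeq> (0 :: int ^ 4)" using p_ge_3 by (auto simp: veq_def cong_0_iff)
    from R[OF this, of 0] show ?thesis by linarith
  qed
  \<comment> \<open>For \<open>x = 0\<close> the incidence is all of \<open>G\<close> or empty.\<close>
  have d0: "(?d (0, t)) ^ 4 \<le> (if t = 0 then real p ^ 4 * N ^ 4 else N ^ 4)" if t: "t \<in> F" for t
  proof (cases "t = 0")
    case True
    have "incidence G 0 t \<le> N" unfolding incidence_def N_def
      using fin by (intro of_nat_mono card_mono) auto
    moreover have "incidence G 0 t \<ge> N" unfolding incidence_def N_def
      using fin True G by (intro of_nat_mono card_mono) (auto simp: hyperplane_def dt_simps)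
    ultimately have "?d (0, t) = real p * N - N" by simp
    moreover have "N \<le> real p * N" using p_pos mult_right_mono[of 1 "real p" N] by (simp add: N_def)
    ultimately have "0 \<le> ?d (0, t)" "?d (0, t) \<le> real p * N" by (auto simp: N_def)
    hence "(?d (0, t)) ^ 4 \<le> (real p * N) ^ 4" by (intro power_mono)
    thus ?thesis using True by (simp add: power_mult_distrib)
  next
    case False
    have "G \<inter> hyperplane (2 *s 0) t = {}"
      using False t nd_F by (auto simp: hyperplane_def dt_simps F_split)
    thus ?thesis using False by (simp add: incidence_def)
  qed
  have dx: "(?d (x, t)) ^ 4 \<le> (real p * R + N)\<^sup>2 * (?d (x, t))\<^sup>2" if x: "x \<in> E" "x \<noteq> 0" for x t
  proof -
    have "\<not> x \<simeq> 0" using x veq_E zero by blast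
    hence "\<not> 2 *s x \<simeq> 0" using not_dvd_2[of 1] p_ge_3 by (auto simp: veq_zero_scale)
    from R[OF this, of t] have i: "incidence G x t \<le> R" by (simp add: incidence_def)
    have "0 \<le> real p * incidence G x t" by (simp add: incidence_def)
    moreover have "real p * incidence G x t \<le> real p * R" using i by (intro mult_left_mono) auto
    ultimately have "\<bar>?d (x, t)\<bar> \<le> \<bar>real p * R + N\<bar>" using R0 by (simp add: N_def abs_le_iff)
    hence "(?d (x, t))\<^sup>2 \<le> (real p * R + N)\<^sup>2" by (simp only: abs_le_square_iff)
    from mult_right_mono[OF this, of "(?d (x, t))\<^sup>2"] show ?thesis
      by (simp add: power4_eq_xxxx power2_eq_square mult.assoc)
  qed
  have "(\<Sum>z\<in>E \<times> F. (?d z) ^ 4) = (\<Sum>x\<in>E. \<Sum>t\<in>F. (?d (x, t)) ^ 4)"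
    by (simp add: sum_times)
  also have "\<dots> = (\<Sum>t\<in>F. (?d (0, t)) ^ 4) + (\<Sum>x\<in>E - {0}. \<Sum>t\<in>F. (?d (x, t)) ^ 4)"
    by (rule sum.remove) (auto simp: zero)
  also have "(\<Sum>t\<in>F. (?d (0, t)) ^ 4) \<le> (\<Sum>t\<in>F. if t = 0 then real p ^ 4 * N ^ 4 else N ^ 4)"
    by (intro sum_mono d0)
  also have "\<dots> = real p ^ 4 * N ^ 4 + real (p - 1) * N ^ 4"
    by (subst sum_F_split) (use p_pos in \<open>simp add: of_nat_diff\<close>)
  also have "\<dots> \<le> real p ^ 4 * N ^ 4 + real p ^ 4 * N ^ 4"
  proof -
    have "real (p - 1) \<le> real p ^ 1" by simp
    also have "\<dots> \<le> real p ^ 4" using p_pos by (intro power_increasing) auto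
    finally show ?thesis by (intro add_left_mono mult_right_mono) auto
  qed
  also have "(\<Sum>x\<in>E - {0}. \<Sum>t\<in>F. (?d (x, t)) ^ 4) \<le> (\<Sum>x\<in>E - {0}. \<Sum>t\<in>F. (real p * R + N)\<^sup>2 * (?d (x, t))\<^sup>2)"
    by (intro sum_mono dx) auto
  also have "\<dots> \<le> (\<Sum>x\<in>E. \<Sum>t\<in>F. (real p * R + N)\<^sup>2 * (?d (x, t))\<^sup>2)"
    by (intro sum_mono2) (auto intro!: sum_nonneg)
  also have "\<dots> = (real p * R + N)\<^sup>2 * (\<Sum>z\<in>E \<times> F. (?d z)\<^sup>2)"
    by (simp add: sum_times sum_distrib_left)
  also have "\<dots> \<le> (real p * R + N)\<^sup>2 * (real p ^ 6 * N)"
    unfolding N_def by (intro mult_left_mono incidence_variance G) auto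
  finally show ?thesis by (simp add: N_def)
qed

text \<open>
  This is the main step. The left-hand side is the part \<open>t = 0\<close> of a sum over all \<open>t\<close> in which
  \<open>e (k * Q (x - x'))\<close> is replaced by \<open>e (k * (Q (x - x') + t))\<close>. In the larger sum the quadratic term
  \<open>Q x'\<close> is absorbed by a translation of \<open>t\<close> and the term \<open>Q x\<close> by the coefficients, after which the
  phases are linear in \<open>(x', t)\<close> and the majorant property removes the coefficients altogether.
\<close>

lemma kernel_l4:
  assumes G: "G \<subseteq> E" and g: "\<And>x. x \<in> G \<Longrightarrow> cmod (g x) \<le> 1"
    and b: "\<And>k. k \<in> F1 \<Longrightarrow> cmod (b k) \<le> K" and K: "K \<ge> 0"
  shows "(\<Sum>x'\<in>E. (cmod (\<Sum>k\<in>F1. b k * (\<Sum>x\<in>G. g x * e (k * ((x - x') \<cdot> (x - x')))))) ^ 4)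
    \<le> K ^ 4 * (\<Sum>z\<in>E \<times> F. (real p * incidence G (fst z) (snd z) - real (card G)) ^ 4)"
proof -
  have fin: "finite G" using G finite_E finite_subset by blast
  let ?I = "F1 \<times> G"
  let ?\<theta> = "\<lambda>i z. e (fst i * (snd z - 2 * (snd i \<cdot> fst z)))"
  let ?c = "\<lambda>i. b (fst i) * g (snd i) * e (fst i * (snd i \<cdot> snd i))"
  let ?H = "\<lambda>x' t. \<Sum>k\<in>F1. b k * (\<Sum>x\<in>G. g x * e (k * ((x - x') \<cdot> (x - x') + t)))"
  \<comment> \<open>Translating \<open>t\<close> by \<open>Q x'\<close> leaves a phase that is linear in \<open>(x', t)\<close>.\<close>
  have H: "?H x' (t + (- (x' \<cdot> x'))) = (\<Sum>i\<in>?I. ?c i * ?\<theta> i (x', t))" for x' t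
  proof -
    have "?H x' (t + (- (x' \<cdot> x'))) = (\<Sum>k\<in>F1. \<Sum>x\<in>G. ?c (k, x) * ?\<theta> (k, x) (x', t))"
      unfolding sum_distrib_left
    proof (intro sum.cong refl)
      fix k x
      have "e (k * ((x - x') \<cdot> (x - x') + (t + (- (x' \<cdot> x'))))) = e (k * (x \<cdot> x)) * e (k * (t - 2 * (x \<cdot> x')))"
        by (simp add: chi_add[symmetric] dt_simps dt_commute[of x' x] algebra_simps)
      thus "b k * (g x * e (k * ((x - x') \<cdot> (x - x') + (t + (- (x' \<cdot> x')))))) = ?c (k, x) * ?\<theta> (k, x) (x', t)"
        by simp
    qed
    thus ?thesis by (simp add: sum_times)
  qed
  have "(\<Sum>x'\<in>E. (cmod (\<Sum>k\<in>F1. b k * (\<Sum>x\<in>G. g x * e (k * ((x - x') \<cdot> (x - x')))))) ^ 4)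
      \<le> (\<Sum>x'\<in>E. \<Sum>t\<in>F. (cmod (?H x' t)) ^ 4)"
  proof (intro sum_mono)
    fix x'
    have "(cmod (?H x' 0)) ^ 4 \<le> (\<Sum>t\<in>F. (cmod (?H x' t)) ^ 4)"
      by (rule member_le_sum) (use p_pos in auto)
    thus "(cmod (\<Sum>k\<in>F1. b k * (\<Sum>x\<in>G. g x * e (k * ((x - x') \<cdot> (x - x')))))) ^ 4 \<le> (\<Sum>t\<in>F. (cmod (?H x' t)) ^ 4)"
      by simp
  qed
  also have "\<dots> = (\<Sum>x'\<in>E. \<Sum>t\<in>F. (cmod (?H x' (t + (- (x' \<cdot> x'))))) ^ 4)"
    by (intro sum.cong refl sum_shift_F[symmetric] arg_cong2[where f = power] arg_cong[where f = cmod]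
        arg_cong2[where f = "(*)"] chi_cong cong_mult cong_add cong_refl)
  also have "\<dots> = (\<Sum>z\<in>E \<times> F. (cmod (\<Sum>i\<in>?I. ?c i * ?\<theta> i z)) ^ 4)"
    unfolding H by (simp add: sum_times)
  also have "\<dots> \<le> K ^ 4 * (\<Sum>z\<in>E \<times> F. (cmod (\<Sum>i\<in>?I. ?\<theta> i z)) ^ 4)"
  proof (rule majorant_l4[OF _ K])
    fix i assume "i \<in> ?I"
    hence i: "fst i \<in> F1" "snd i \<in> G" by auto
    show "cmod (?c i) \<le> K"
      using mult_mono[OF b[OF i(1)] g[OF i(2)] K] by (simp add: norm_mult)
  next
    fix i k i' k'
    have "?\<theta> i z * ?\<theta> k z * cnj (?\<theta> i' z * ?\<theta> k' z) = e ((fst i + fst k - fst i' - fst k') * snd z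
       + ((- 2 * fst i) *s snd i + (- 2 * fst k) *s snd k + (2 * fst i') *s snd i' + (2 * fst k') *s snd k') \<cdot> fst z)" for z
      by (simp add: cnj_chi chi_add[symmetric] dt_simps algebra_simps)
    thus "\<exists>r\<ge>0. (\<Sum>z\<in>E \<times> F. ?\<theta> i z * ?\<theta> k z * cnj (?\<theta> i' z * ?\<theta> k' z)) = complex_of_real r"
      by (simp only: phase_orth) (auto intro: exI[of _ "real p ^ 5"] exI[of _ 0])
  qed
  also have "\<dots> = K ^ 4 * (\<Sum>z\<in>E \<times> F. (real p * incidence G (fst z) (snd z) - real (card G)) ^ 4)"
    unfolding sum_phase[OF G] norm_of_real by simp
  finally show ?thesis .
qed

end

context finite_sphere
begin

text \<open>
  Hoelder's inequality in the bilinear form of \<open>hat_sphere_energy\<close>, after the sum over the nontrivial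
  characters has been reindexed by \<open>k = dual t\<close>. The fourth power of \<open>X\<close> is estimated so as to avoid
  fractional powers.
\<close>

lemma restricted_energy:
  assumes G: "G \<subseteq> E" and R: "\<And>v b. \<not> v \<simeq> 0 \<Longrightarrow> real (card (G \<inter> hyperplane v b)) \<le> R"
    and g: "\<And>x. x \<in> G \<Longrightarrow> cmod (g x) \<le> 1"
  obtains X where "X \<ge> 0"
    "real p * (\<Sum>y\<in>S. (cmod (hat G g y))\<^sup>2) \<le> real p ^ 4 * real (card G) + X"
    "X ^ 4 \<le> real (card G) ^ 3 * real p ^ 8 *
       (2 * real p ^ 4 * real (card G) ^ 4 + (real p * R + real (card G))\<^sup>2 * (real p ^ 6 * real (card G)))"
proof -
  have fin: "finite G" using G finite_E finite_subset by blast
  let ?inv = "the_inv_into F1 dual"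
  let ?b = "\<lambda>k. e (- (?inv k * j)) * gauss (?inv k)"
  let ?H = "\<lambda>x'. \<Sum>k\<in>F1. ?b k * (\<Sum>x\<in>G. g x * e (k * ((x - x') \<cdot> (x - x'))))"
  let ?X = "\<Sum>x'\<in>G. cmod (?H x')"
  have inj: "inj_on dual F1" using dual_bij by (simp add: bij_betw_def)
  have inv: "?inv (dual t) = t" if "t \<in> F1" for t by (rule the_inv_into_f_f[OF inj that])
  have reindex: "(\<Sum>t\<in>F1. e (- (t * j)) * gauss t * (\<Sum>x\<in>G. g x * e (dual t * ((x - x') \<cdot> (x - x')))))
      = ?H x'" for x'
    by (subst sum.reindex_bij_betw[OF dual_bij, symmetric]) (simp add: inv)
  have bnorm: "cmod (?b k) \<le> real p ^ 2" if "k \<in> F1" for k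
  proof -
    have "?inv k \<in> F1" using the_inv_into_into[OF inj, of k F1] that dual_bij by (auto simp: bij_betw_def)
    thus ?thesis by (simp add: norm_mult norm_gauss nd_F)
  qed
  have "real p * (\<Sum>y\<in>S. (cmod (hat G g y))\<^sup>2) \<le> cmod (of_real (real p * (\<Sum>y\<in>S. (cmod (hat G g y))\<^sup>2)))"
    unfolding norm_of_real by (rule abs_ge_self)
  also have "\<dots> \<le> cmod (of_real (real p ^ 4 * (\<Sum>x\<in>G. (cmod (g x))\<^sup>2))) + cmod (\<Sum>x'\<in>G. cnj (g x') * ?H x')"
    unfolding hat_sphere_energy[OF G] reindex by (rule norm_triangle_ineq)
  also have "\<dots> \<le> real p ^ 4 * real (card G) + ?X"
  proof (rule add_mono)
    have "(\<Sum>x\<in>G. (cmod (g x))\<^sup>2) \<le> (\<Sum>x\<in>G. 1)"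
      using g by (intro sum_mono power_le_one) auto
    thus "cmod (of_real (real p ^ 4 * (\<Sum>x\<in>G. (cmod (g x))\<^sup>2))) \<le> real p ^ 4 * real (card G)"
      unfolding norm_of_real by (simp add: abs_mult sum_nonneg mult_left_mono)
    have "cmod (\<Sum>x'\<in>G. cnj (g x') * ?H x') \<le> (\<Sum>x'\<in>G. cmod (cnj (g x') * ?H x'))" by (rule norm_sum)
    also have "\<dots> \<le> ?X"
    proof (rule sum_mono)
      fix x' assume "x' \<in> G"
      from mult_right_mono[OF g[OF this], of "cmod (?H x')"]
      show "cmod (cnj (g x') * ?H x') \<le> cmod (?H x')" by (simp add: norm_mult)
    qed
    finally show "cmod (\<Sum>x'\<in>G. cnj (g x') * ?H x') \<le> ?X" .
  qed
  finally have 1: "real p * (\<Sum>y\<in>S. (cmod (hat G g y))\<^sup>2) \<le> real p ^ 4 * real (card G) + ?X" .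
  have "?X ^ 4 \<le> real (card G) ^ 3 * (\<Sum>x'\<in>G. (cmod (?H x')) ^ 4)" by (rule sum_power4)
  also have "\<dots> \<le> real (card G) ^ 3 * (\<Sum>x'\<in>E. (cmod (?H x')) ^ 4)"
    using G by (intro mult_left_mono sum_mono2) auto
  also have "\<dots> \<le> real (card G) ^ 3 * ((real p ^ 2) ^ 4 *
      (\<Sum>z\<in>E \<times> F. (real p * incidence G (fst z) (snd z) - real (card G)) ^ 4))"
    using bnorm by (intro mult_left_mono kernel_l4 G g) auto
  also have "\<dots> \<le> real (card G) ^ 3 * ((real p ^ 2) ^ 4 *
      (2 * real p ^ 4 * real (card G) ^ 4 + (real p * R + real (card G))\<^sup>2 * (real p ^ 6 * real (card G))))"
    by (intro mult_left_mono incidence_l4 G R) auto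
  finally have 2: "?X ^ 4 \<le> real (card G) ^ 3 * real p ^ 8 *
      (2 * real p ^ 4 * real (card G) ^ 4 + (real p * R + real (card G))\<^sup>2 * (real p ^ 6 * real (card G)))"
    by (simp add: power_mult[symmetric] mult.assoc)
  show ?thesis by (rule that[OF _ 1 2]) (simp add: sum_nonneg)
qed

end

section \<open>Level sets of the extension\<close>

text \<open>
  The numerical content of \<open>level_set_bound_flat\<close>. If the diagonal term dominates, \<open>N * L\<^sup>2\<close> is
  \<open>O(P^3)\<close> and the bound \<open>top\<close> for \<open>L\<close> gives the claim. Otherwise the fourth power of the energy
  inequality has three terms on the right. The one with \<open>N^3\<close> gives the second alternative; the ones
  with \<open>R\<^sup>2\<close> and \<open>N\<^sup>2\<close> give the first, the latter by \<open>L \<ge> sqrt P\<close>.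
\<close>

lemma level_arith:
  fixes N P L X R :: real
  assumes P: "P > 0" and N: "N \<ge> 0" and L: "L > 0" "L \<ge> sqrt P" and R: "R * L\<^sup>2 = 8 * P ^ 3"
    and E: "P * (L\<^sup>2 * N\<^sup>2) \<le> P ^ 4 * N + X" and X: "X \<ge> 0"
    and X4: "X ^ 4 \<le> N ^ 3 * P ^ 8 * (2 * P ^ 4 * N ^ 4 + (P * R + N)\<^sup>2 * (P ^ 6 * N))"
    and top: "N > 0 \<Longrightarrow> L\<^sup>2 \<le> 2 * P ^ 3"
  shows "N * L ^ 3 \<le> 10 * P ^ 4 * sqrt P \<or> N * L ^ 8 \<le> 96 * P ^ 8"
proof (cases "N = 0")
  case True
  thus ?thesis using P by simp
next
  case False
  hence N0: "N > 0" using N by simp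
  define s where "s = sqrt P"
  have s: "s > 0" "P = s ^ 2" using P by (auto simp: s_def)
  show ?thesis
  proof (cases "X \<le> P ^ 4 * N")
    case True
    hence "(P * N) * (N * L\<^sup>2) \<le> (P * N) * (2 * P ^ 3)"
      using E by (simp add: power2_eq_square power3_eq_cube power4_eq_xxxx mult_ac)
    hence 1: "N * L\<^sup>2 \<le> 2 * P ^ 3" using P N0 by (subst (asm) mult_le_cancel_left_pos) auto
    have "L\<^sup>2 \<le> 2 * s ^ 6" using top[OF N0] by (simp add: s(2) power_mult[symmetric])
    also have "\<dots> \<le> 4 * s ^ 6" using s(1) by (intro mult_right_mono) auto
    also have "\<dots> = (2 * s ^ 3)\<^sup>2" by (simp add: power_mult_distrib power_mult[symmetric])
    finally have "L\<^sup>2 \<le> (2 * s ^ 3)\<^sup>2" .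
    hence 2: "L \<le> 2 * s ^ 3" by (rule power2_le_imp_le) (use s(1) in auto)
    have "N * L ^ 3 = (N * L\<^sup>2) * L" by (simp add: power2_eq_square power3_eq_cube)
    also have "\<dots> \<le> (2 * P ^ 3) * (2 * s ^ 3)"
      by (rule mult_mono[OF 1 2]) (use P L(1) in auto)
    also have "\<dots> = 4 * s ^ 9"
      by (simp add: s(2) eval_nat_numeral)
    also have "\<dots> \<le> 10 * s ^ 9" using s(1) by (intro mult_right_mono) auto
    also have "\<dots> = 10 * P ^ 4 * s"
      by (simp add: s(2) eval_nat_numeral)
    finally show ?thesis by (simp add: s_def)
  next
    case False
    hence "P * (L\<^sup>2 * N\<^sup>2) \<le> 2 * X" using E by simp
    hence "(P * (L\<^sup>2 * N\<^sup>2)) ^ 4 \<le> (2 * X) ^ 4" using P by (intro power_mono) auto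
    also have "\<dots> = 16 * X ^ 4" by (simp add: power_mult_distrib)
    also have "\<dots> \<le> 16 * (N ^ 3 * P ^ 8 * (2 * P ^ 4 * N ^ 4 + (P * R + N)\<^sup>2 * (P ^ 6 * N)))"
      using X4 by (intro mult_left_mono) auto
    also have "\<dots> \<le> 16 * (N ^ 3 * P ^ 8 * (2 * P ^ 4 * N ^ 4 + (2 * (P * R)\<^sup>2 + 2 * N\<^sup>2) * (P ^ 6 * N)))"
    proof -
      have "(P * R + N)\<^sup>2 \<le> 2 * (P * R)\<^sup>2 + 2 * N\<^sup>2"
        using zero_le_power2[of "P * R - N"] by (simp add: power2_eq_square algebra_simps)
      thus ?thesis using P N by (intro mult_left_mono add_left_mono mult_right_mono) auto
    qed
    also have "\<dots> = (P ^ 4 * N ^ 4) * (32 * P ^ 8 * N ^ 3 + 32 * P ^ 12 * R\<^sup>2 + 32 * P ^ 10 * N\<^sup>2)"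
      by (simp add: eval_nat_numeral algebra_simps)
    also have "(P * (L\<^sup>2 * N\<^sup>2)) ^ 4 = (P ^ 4 * N ^ 4) * (L ^ 8 * N ^ 4)"
      by (simp add: eval_nat_numeral mult_ac)
    finally have "(P ^ 4 * N ^ 4) * (L ^ 8 * N ^ 4)
       \<le> (P ^ 4 * N ^ 4) * (32 * P ^ 8 * N ^ 3 + 32 * P ^ 12 * R\<^sup>2 + 32 * P ^ 10 * N\<^sup>2)" .
    hence main: "L ^ 8 * N ^ 4 \<le> 32 * P ^ 8 * N ^ 3 + 32 * P ^ 12 * R\<^sup>2 + 32 * P ^ 10 * N\<^sup>2"
      using P N0 by (subst (asm) mult_le_cancel_left_pos) auto
    consider (a) "L ^ 8 * N ^ 4 \<le> 96 * P ^ 8 * N ^ 3" | (b) "L ^ 8 * N ^ 4 \<le> 96 * P ^ 12 * R\<^sup>2"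
      | (c) "L ^ 8 * N ^ 4 \<le> 96 * P ^ 10 * N\<^sup>2"
      using main by linarith
    thus ?thesis
    proof cases
      case a
      hence "N ^ 3 * (N * L ^ 8) \<le> N ^ 3 * (96 * P ^ 8)"
        by (simp add: numeral_eq_Suc mult_ac)
      hence "N * L ^ 8 \<le> 96 * P ^ 8" using N0 by (subst (asm) mult_le_cancel_left_pos) auto
      thus ?thesis by blast
    next
      case b
      have "(N * L ^ 3) ^ 4 = (L ^ 8 * N ^ 4) * L ^ 4"
        by (simp add: eval_nat_numeral mult_ac)
      also have "\<dots> \<le> (96 * P ^ 12 * R\<^sup>2) * L ^ 4" using b L by (intro mult_right_mono) auto
      also have "\<dots> = 96 * P ^ 12 * (R * L\<^sup>2)\<^sup>2"
        by (simp add: eval_nat_numeral mult_ac)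
      also have "\<dots> = 6144 * (P ^ 4 * s) ^ 4"
        unfolding R by (simp add: s(2) eval_nat_numeral mult_ac)
      also have "\<dots> \<le> 10000 * (P ^ 4 * s) ^ 4" by (intro mult_right_mono) auto
      also have "\<dots> = (10 * P ^ 4 * s) ^ 4" by (simp add: power_mult_distrib)
      finally have "N * L ^ 3 \<le> 10 * P ^ 4 * s"
        by (rule power_le_imp_le_base[of _ 3, simplified]) (use P s in auto)
      thus ?thesis by (simp add: s_def)
    next
      case c
      hence "N\<^sup>2 * (N * L ^ 4)\<^sup>2 \<le> N\<^sup>2 * (96 * P ^ 10)"
        by (simp add: eval_nat_numeral mult_ac)
      hence "(N * L ^ 4)\<^sup>2 \<le> 96 * P ^ 10" using N0 by (subst (asm) mult_le_cancel_left_pos) auto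
      also have "\<dots> \<le> 100 * P ^ 10" using P by (intro mult_right_mono) auto
      also have "\<dots> = (10 * P ^ 5)\<^sup>2" by (simp add: power_mult_distrib power_mult[symmetric])
      finally have 1: "N * L ^ 4 \<le> 10 * P ^ 5" by (rule power2_le_imp_le) (use P in auto)
      have "s * (N * L ^ 3) \<le> L * (N * L ^ 3)" using L N by (intro mult_right_mono) (auto simp: s_def)
      also have "\<dots> = N * L ^ 4" by (simp add: numeral_eq_Suc)
      also note 1
      also have "10 * P ^ 5 = s * (10 * P ^ 4 * s)"
        by (simp add: s(2) eval_nat_numeral mult_ac)
      finally have "N * L ^ 3 \<le> 10 * P ^ 4 * s" using s(1) by (subst (asm) mult_le_cancel_left_pos) auto
      thus ?thesis by (simp add: s_def)
    qed
  qed
qed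

context odd_prime
begin

lemma hat_sup:
  assumes A: "finite A" and f1: "(\<Sum>y\<in>A. (cmod (f y))\<^sup>2) \<le> 1"
  shows "(cmod (hat A f x))\<^sup>2 \<le> real (card A)"
proof -
  have "cmod (hat A f x) \<le> (\<Sum>y\<in>A. 1 * cmod (f y))"
    unfolding hat_def by (rule order_trans[OF norm_sum]) (simp add: norm_mult)
  hence "(cmod (hat A f x))\<^sup>2 \<le> (\<Sum>y\<in>A. 1 * cmod (f y))\<^sup>2" by (intro power_mono) auto
  also have "\<dots> \<le> (\<Sum>y\<in>A. 1\<^sup>2) * (\<Sum>y\<in>A. (cmod (f y))\<^sup>2)" by (rule Cauchy_Schwarz_ineq_sum)
  also have "\<dots> \<le> (\<Sum>y\<in>A. 1\<^sup>2) * 1" using f1 by (intro mult_left_mono) auto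
  finally show ?thesis by simp
qed

end

context finite_sphere
begin

text \<open>
  The function \<open>g\<close> consists of the conjugate phases of \<open>hat S f\<close> on \<open>G\<close>.
\<close>

lemma duality:
  assumes G: "finite G" and f1: "(\<Sum>y\<in>S. (cmod (f y))\<^sup>2) \<le> 1"
    and L: "L \<ge> 0" "\<And>x. x \<in> G \<Longrightarrow> cmod (hat S f x) \<ge> L"
  obtains g where "\<And>x. cmod (g x) \<le> 1" "L\<^sup>2 * (real (card G))\<^sup>2 \<le> (\<Sum>y\<in>S. (cmod (hat G g y))\<^sup>2)"
proof -
  define g where "g = (\<lambda>x. cnj (sgn (hat S f x)))"
  have g1: "cmod (g x) \<le> 1" for x by (simp add: g_def norm_sgn)
  have gU: "g x * hat S f x = of_real (cmod (hat S f x))" for x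
  proof (cases "hat S f x = 0")
    case False
    thus ?thesis by (simp add: g_def sgn_div_norm scaleR_conv_of_real mult.commute[of "cnj _"]
        complex_norm_square[symmetric] power2_eq_square field_simps)
  qed simp
  have "of_real (\<Sum>x\<in>G. cmod (hat S f x)) = (\<Sum>x\<in>G. g x * hat S f x)" by (simp add: gU)
  also have "\<dots> = (\<Sum>y\<in>S. f y * hat G g y)"
    unfolding hat_def sum_distrib_left by (subst sum.swap) (simp add: dt_commute mult_ac)
  finally have "cmod (complex_of_real (\<Sum>x\<in>G. cmod (hat S f x))) = cmod (\<Sum>y\<in>S. f y * hat G g y)"
    by (rule arg_cong)
  hence "(\<Sum>x\<in>G. cmod (hat S f x)) = cmod (\<Sum>y\<in>S. f y * hat G g y)"
    unfolding norm_of_real by (simp add: sum_nonneg)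
  also have "\<dots> \<le> (\<Sum>y\<in>S. cmod (f y) * cmod (hat G g y))"
    by (rule order_trans[OF norm_sum]) (simp add: norm_mult)
  finally have 1: "(\<Sum>x\<in>G. cmod (hat S f x)) \<le> (\<Sum>y\<in>S. cmod (f y) * cmod (hat G g y))" .
  have "L * real (card G) = (\<Sum>x\<in>G. L)" by simp
  also have "\<dots> \<le> (\<Sum>x\<in>G. cmod (hat S f x))" using L by (intro sum_mono)
  also note 1
  finally have "(L * real (card G))\<^sup>2 \<le> (\<Sum>y\<in>S. cmod (f y) * cmod (hat G g y))\<^sup>2"
    using L(1) by (intro power_mono) auto
  also have "\<dots> \<le> (\<Sum>y\<in>S. (cmod (f y))\<^sup>2) * (\<Sum>y\<in>S. (cmod (hat G g y))\<^sup>2)"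
    by (rule Cauchy_Schwarz_ineq_sum)
  also have "\<dots> \<le> 1 * (\<Sum>y\<in>S. (cmod (hat G g y))\<^sup>2)"
    using f1 by (intro mult_right_mono sum_nonneg) auto
  finally have "L\<^sup>2 * (real (card G))\<^sup>2 \<le> (\<Sum>y\<in>S. (cmod (hat G g y))\<^sup>2)"
    by (simp add: power_mult_distrib)
  with g1 show ?thesis by (rule that)
qed

lemma level_set_bound_flat:
  assumes f1: "(\<Sum>y\<in>S. (cmod (f y))\<^sup>2) \<le> 1" and flat: "\<And>y. y \<in> S \<Longrightarrow> (cmod (f y))\<^sup>2 \<le> 1 / real p"
    and L: "L \<ge> sqrt (real p)"
  shows "real (card {x \<in> E. cmod (hat S f x) > L}) \<le> 586 * real p ^ 4 * sqrt (real p) / L ^ 3 + 96 * real p ^ 8 / L ^ 8"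
proof -
  define P where "P = real p"
  have P: "P > 0" using p_pos by (simp add: P_def)
  have L0: "L > 0" using less_le_trans[OF real_sqrt_gt_zero[OF P], of L] L by (simp add: P_def)
  let ?M = "{x \<in> E. cmod (hat S f x) > L}"
  let ?B = "exceptional f L"
  define G where "G = ?M - ?B"
  define N where "N = real (card G)"
  have GE: "G \<subseteq> E" by (auto simp: G_def)
  have finG: "finite G" using GE finite_E finite_subset by blast
  define R where "R = 8 * P ^ 3 / L\<^sup>2"
  have hyperplane: "real (card (G \<inter> hyperplane v b)) \<le> R" if "\<not> v \<simeq> 0" for v b
    using card_level_hyperplane[OF f1 L0 that, of G b] L0 by (simp add: R_def P_def G_def pos_le_divide_eq)
  obtain g where g: "\<And>x. cmod (g x) \<le> 1" "L\<^sup>2 * (real (card G))\<^sup>2 \<le> (\<Sum>y\<in>S. (cmod (hat G g y))\<^sup>2)"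
    using duality[OF finG f1, of L] L0 by (auto simp: G_def)
  obtain X where X: "X \<ge> 0"
    "real p * (\<Sum>y\<in>S. (cmod (hat G g y))\<^sup>2) \<le> real p ^ 4 * real (card G) + X"
    "X ^ 4 \<le> real (card G) ^ 3 * real p ^ 8 *
       (2 * real p ^ 4 * real (card G) ^ 4 + (real p * R + real (card G))\<^sup>2 * (real p ^ 6 * real (card G)))"
    using restricted_energy[OF GE hyperplane, of g] g(1) by blast
  have "P * (L\<^sup>2 * N\<^sup>2) \<le> P * (\<Sum>y\<in>S. (cmod (hat G g y))\<^sup>2)"
    using g(2) P by (intro mult_left_mono) (auto simp: N_def)
  hence E: "P * (L\<^sup>2 * N\<^sup>2) \<le> P ^ 4 * N + X" using X(2) by (simp add: P_def N_def)
  have top: "L\<^sup>2 \<le> 2 * P ^ 3" if N: "N > 0"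
  proof -
    have "G \<noteq> {}" using N by (auto simp: N_def)
    then obtain x where x: "x \<in> G" by blast
    have "L\<^sup>2 \<le> (cmod (hat S f x))\<^sup>2" using x L0 by (intro power_mono) (auto simp: G_def)
    also have "\<dots> \<le> real (card S)" by (rule hat_sup[OF finite_S f1])
    also have "\<dots> \<le> 2 * P ^ 3" using card_S(2) by (simp add: P_def)
    finally show ?thesis .
  qed
  have "N * L ^ 3 \<le> 10 * P ^ 4 * sqrt P \<or> N * L ^ 8 \<le> 96 * P ^ 8"
  proof (rule level_arith[OF P _ L0 _ _ E X(1) _ top])
    show "R * L\<^sup>2 = 8 * P ^ 3" using L0 by (simp add: R_def)
    show "X ^ 4 \<le> N ^ 3 * P ^ 8 * (2 * P ^ 4 * N ^ 4 + (P * R + N)\<^sup>2 * (P ^ 6 * N))"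
      using X(3) by (simp only: N_def P_def)
  qed (use L in \<open>auto simp: N_def P_def\<close>)
  hence "N \<le> 10 * P ^ 4 * sqrt P / L ^ 3 \<or> N \<le> 96 * P ^ 8 / L ^ 8"
    using L0 by (simp add: pos_le_divide_eq)
  hence NG: "N \<le> 10 * P ^ 4 * sqrt P / L ^ 3 + 96 * P ^ 8 / L ^ 8"
    using P L0 by (auto intro: add_increasing add_increasing2)
  have "real (card ?B) * L ^ 4 \<le> 576 * P ^ 5"
    using card_exceptional[OF f1 flat L0] by (simp add: P_def)
  have "real (card ?B) * L ^ 3 * sqrt P \<le> real (card ?B) * L ^ 3 * L"
    using L L0 by (intro mult_left_mono) (auto simp: P_def)
  also have "\<dots> = real (card ?B) * L ^ 4" by (simp add: numeral_eq_Suc)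
  also have "\<dots> \<le> 576 * P ^ 5" by fact
  also have "\<dots> = 576 * P ^ 4 * sqrt P * sqrt P" using P by (simp add: numeral_eq_Suc)
  finally have "real (card ?B) * L ^ 3 \<le> 576 * P ^ 4 * sqrt P" using P by simp
  \<comment> \<open>By \<open>L \<ge> sqrt p\<close> the exceptional set is no larger than the first term allows.\<close>
  hence NB: "real (card ?B) \<le> 576 * P ^ 4 * sqrt P / L ^ 3" using L0 by (simp add: pos_le_divide_eq)
  have "?M \<subseteq> G \<union> ?B" by (auto simp: G_def)
  hence "card ?M \<le> card (G \<union> ?B)" using finG by (intro card_mono) (auto simp: exceptional_def)
  also have "\<dots> \<le> card G + card ?B" by (rule card_Un_le)
  finally have "real (card ?M) \<le> N + real (card ?B)" by (simp add: N_def)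
  also have "\<dots> \<le> (10 * P ^ 4 * sqrt P / L ^ 3 + 96 * P ^ 8 / L ^ 8) + 576 * P ^ 4 * sqrt P / L ^ 3"
    by (intro add_mono NG NB)
  also have "\<dots> = 586 * P ^ 4 * sqrt P / L ^ 3 + 96 * P ^ 8 / L ^ 8" by (simp add: add_divide_distrib[symmetric])
  finally show ?thesis by (simp add: P_def)
qed

text \<open>
  Points where \<open>|f|\<^sup>2 > 1 / p\<close> number fewer than \<open>p\<close>, since the total mass is at most \<open>1\<close>. Their
  contribution to the extension is at most \<open>sqrt p \<le> L / 2\<close>, so they can be dropped if \<open>L\<close> is halved.
\<close>

lemma level_set_bound:
  assumes f1: "(\<Sum>y\<in>S. (cmod (f y))\<^sup>2) \<le> 1" and L: "L \<ge> 2 * sqrt (real p)"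
  shows "real (card {x \<in> E. cmod (hat S f x) > L}) \<le> 4688 * real p ^ 4 * sqrt (real p) / L ^ 3 + 24576 * real p ^ 8 / L ^ 8"
proof -
  let ?Hv = "{y \<in> S. (cmod (f y))\<^sup>2 > 1 / real p}"
  define h where "h = (\<lambda>y. if y \<in> ?Hv then 0 else f y)"
  have p0: "real p > 0" using p_pos by simp
  have L0: "L > 0" using L real_sqrt_gt_zero[OF p0] by linarith
  have le: "(cmod (h y))\<^sup>2 \<le> (cmod (f y))\<^sup>2" for y by (simp add: h_def)
  have h1: "(\<Sum>y\<in>S. (cmod (h y))\<^sup>2) \<le> 1" using sum_mono[OF le] f1 by (rule order_trans)
  have hflat: "(cmod (h y))\<^sup>2 \<le> 1 / real p" if "y \<in> S" for y using that p0 by (auto simp: h_def)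
  have mass: "(\<Sum>y\<in>?Hv. (cmod (f y))\<^sup>2) \<le> 1"
  proof -
    have "(\<Sum>y\<in>?Hv. (cmod (f y))\<^sup>2) \<le> (\<Sum>y\<in>S. (cmod (f y))\<^sup>2)" by (rule sum_mono2) auto
    thus ?thesis using f1 by linarith
  qed
  have "real (card ?Hv) * (1 / real p) = (\<Sum>y\<in>?Hv. 1 / real p)" by simp
  also have "\<dots> \<le> (\<Sum>y\<in>?Hv. (cmod (f y))\<^sup>2)" by (intro sum_mono) auto
  also note mass
  finally have cH: "real (card ?Hv) \<le> real p" using p0 by (simp add: field_simps)
  have split: "hat S f x = hat S h x + hat ?Hv f x" for x
  proof -
    have "hat S f x = (\<Sum>y\<in>S. h y * e (y \<cdot> x) + (if y \<in> ?Hv then f y * e (y \<cdot> x) else 0))"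
      unfolding hat_def by (intro sum.cong refl) (simp add: h_def)
    also have "\<dots> = hat S h x + hat ?Hv f x"
      unfolding sum.distrib hat_def by (subst sum.inter_filter[symmetric]) auto
    finally show ?thesis .
  qed
  have small: "cmod (hat ?Hv f x) \<le> L / 2" for x
  proof -
    have "(cmod (hat ?Hv f x))\<^sup>2 \<le> real p" using hat_sup[of ?Hv f x] mass cH by simp
    hence "cmod (hat ?Hv f x) \<le> sqrt (real p)" by (rule real_le_rsqrt)
    thus ?thesis using L by simp
  qed
  have "cmod (hat S h x) > L / 2" if "cmod (hat S f x) > L" for x
    using that small[of x] norm_triangle_ineq[of "hat S h x" "hat ?Hv f x"] split[of x] by simp
  hence "{x \<in> E. cmod (hat S f x) > L} \<subseteq> {x \<in> E. cmod (hat S h x) > L / 2}" by auto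
  hence "real (card {x \<in> E. cmod (hat S f x) > L}) \<le> real (card {x \<in> E. cmod (hat S h x) > L / 2})"
    by (intro of_nat_mono card_mono) auto
  also have "\<dots> \<le> 586 * real p ^ 4 * sqrt (real p) / (L / 2) ^ 3 + 96 * real p ^ 8 / (L / 2) ^ 8"
    using L by (intro level_set_bound_flat h1 hflat) auto
  also have "\<dots> = 4688 * real p ^ 4 * sqrt (real p) / L ^ 3 + 24576 * real p ^ 8 / L ^ 8"
    by (simp add: power_divide)
  finally show ?thesis .
qed

end

section \<open>From level sets to the endpoint estimate\<close>

lemma geometric_up: "(\<Sum>k<n. (2 powr (1/5)) ^ k) \<le> (10::real) * (2 powr (1/5)) ^ n"
proof -
  let ?q = "2 powr (1/5) :: real"
  have "(11/10 :: real) ^ 5 \<le> ?q ^ 5"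
    by (simp add: powr_realpow[symmetric] powr_powr power_divide)
  hence q: "11/10 \<le> ?q" by (rule power_le_imp_le_base[of _ 4, simplified]) auto
  have "(\<Sum>k<n. ?q ^ k) = (?q ^ n - 1) / (?q - 1)"
    using q by (intro geometric_sum) auto
  also have "\<dots> \<le> ?q ^ n / (1/10)"
    using q by (intro frac_le) auto
  finally show ?thesis by simp
qed

lemma geometric_down: "(\<Sum>k<n. (2 powr (-24/5)) ^ k) \<le> (2::real)"
proof -
  let ?q = "2 powr (-24/5) :: real"
  have "?q \<le> 2 powr (-1)" by (intro powr_mono) auto
  hence q: "?q \<le> 1/2" by (simp add: powr_minus_divide)
  have "(\<Sum>k<n. ?q ^ k) \<le> (\<Sum>k<n. (1/2) ^ k)"
    using q by (intro sum_mono power_mono) auto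
  also have "\<dots> = ((1/2) ^ n - 1) / (1/2 - 1)" by (rule geometric_sum) simp
  also have "\<dots> \<le> 2" by (simp add: field_simps)
  finally show ?thesis .
qed

lemma power_two_powr: "(2 ^ k) powr a = (2 powr a) ^ k" for a :: real
  by (induction k) (simp_all add: powr_mult)

text \<open>
  The dyadic layer \<open>u < w x \<le> 2 * u\<close> contributes at most the number of its points times
  \<open>(2 * u) powr (16/5)\<close>.
\<close>

lemma layer_sum:
  fixes w :: "'x \<Rightarrow> real"
  assumes X: "finite X" and L: "L > 0" and AB: "A \<ge> 0" "B \<ge> 0"
    and N: "\<And>t. t \<ge> L \<Longrightarrow> real (card {x \<in> X. w x > t}) \<le> A / t ^ 3 + B / t ^ 8"
  shows "(\<Sum>x | x \<in> X \<and> L < w x \<and> w x \<le> 2 ^ n * L. w x powr (16/5))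
     \<le> (\<Sum>k<n. 16 * (A * (2 ^ k * L) powr (1/5) + B * (2 ^ k * L) powr (-24/5)))"
proof (induction n)
  case 0
  have "{x. x \<in> X \<and> L < w x \<and> w x \<le> 2 ^ 0 * L} = {}" by auto
  thus ?case by (simp only: sum.empty) simp
next
  case (Suc n)
  define u where "u = 2 ^ n * L"
  have u: "u > 0" "u \<ge> L" using L by (auto simp: u_def)
  let ?Y = "{x. x \<in> X \<and> u < w x \<and> w x \<le> 2 * u}"
  have fin: "finite ?Y" using X by simp
  have uL: "2 ^ Suc n * L = 2 * u" by (simp add: u_def)
  have "{x. x \<in> X \<and> L < w x \<and> w x \<le> 2 ^ Suc n * L} \<subseteq> {x. x \<in> X \<and> L < w x \<and> w x \<le> 2 ^ n * L} \<union> ?Y"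
    unfolding uL by (auto simp: u_def)
  hence "(\<Sum>x | x \<in> X \<and> L < w x \<and> w x \<le> 2 ^ Suc n * L. w x powr (16/5))
     \<le> (\<Sum>x\<in>{x. x \<in> X \<and> L < w x \<and> w x \<le> 2 ^ n * L} \<union> ?Y. w x powr (16/5))"
    using X by (intro sum_mono2) auto
  also have "\<dots> \<le> (\<Sum>x | x \<in> X \<and> L < w x \<and> w x \<le> 2 ^ n * L. w x powr (16/5)) + (\<Sum>x\<in>?Y. w x powr (16/5))"
  proof -
    have "(\<Sum>x\<in>{x. x \<in> X \<and> L < w x \<and> w x \<le> 2 ^ n * L} \<union> ?Y. w x powr (16/5))
      = (\<Sum>x | x \<in> X \<and> L < w x \<and> w x \<le> 2 ^ n * L. w x powr (16/5)) + (\<Sum>x\<in>?Y. w x powr (16/5))"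
      using X by (intro sum.union_disjoint) (auto simp: u_def)
    thus ?thesis by simp
  qed
  also have "(\<Sum>x\<in>?Y. w x powr (16/5)) \<le> (\<Sum>x\<in>?Y. (2 * u) powr (16/5))"
    using u by (intro sum_mono powr_mono2) auto
  also have "\<dots> = real (card ?Y) * (2 * u) powr (16/5)" by simp
  also have "\<dots> \<le> (A / u ^ 3 + B / u ^ 8) * (2 * u) powr (16/5)"
  proof (rule mult_right_mono)
    have "card ?Y \<le> card {x \<in> X. w x > u}" using X by (intro card_mono) auto
    thus "real (card ?Y) \<le> A / u ^ 3 + B / u ^ 8" using N[OF u(2)] by linarith
  qed simp
  also have "\<dots> \<le> (A / u ^ 3 + B / u ^ 8) * (16 * u powr (16/5))"
  proof (rule mult_left_mono)
    have "(2::real) powr (16/5) \<le> 2 powr 4" by (intro powr_mono) auto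
    thus "(2 * u) powr (16/5) \<le> 16 * u powr (16/5)"
      using u by (simp add: powr_mult mult_right_mono)
  qed (use AB u in auto)
  also have "\<dots> = 16 * (A * u powr (1/5) + B * u powr (-24/5))"
  proof -
    have e: "u powr (16/5) = u powr (1/5) * u ^ 3" "u powr (16/5) = u powr (-24/5) * u ^ 8"
      using u powr_add[of u "1/5" 3] powr_add[of u "-24/5" 8] by simp_all
    have "A / u ^ 3 * u powr (16/5) = A * u powr (1/5)" unfolding e(1) using u by simp
    moreover have "B / u ^ 8 * u powr (16/5) = B * u powr (-24/5)" unfolding e(2) using u by simp
    moreover have "(A / u ^ 3 + B / u ^ 8) * (16 * u powr (16/5))
        = 16 * (A / u ^ 3 * u powr (16/5) + B / u ^ 8 * u powr (16/5))"
      by (simp only: distrib_right distrib_left mult_ac)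
    ultimately show ?thesis by (simp only:)
  qed
  finally show ?case using Suc.IH unfolding u_def by simp
qed

text \<open>
  The exponent \<open>16/5\<close> lies strictly between \<open>3\<close> and \<open>8\<close>, so the first term of the level bound sums to
  its value at the top layer and the second to its value at the bottom layer, without a logarithm.
\<close>

lemma weak_to_strong:
  fixes w :: "'x \<Rightarrow> real"
  assumes X: "finite X" and L: "L > 0" and AB: "A \<ge> 0" "B \<ge> 0"
    and N: "\<And>t. t \<ge> L \<Longrightarrow> real (card {x \<in> X. w x > t}) \<le> A / t ^ 3 + B / t ^ 8"
    and T: "\<And>x. x \<in> X \<Longrightarrow> w x \<le> T"
  shows "(\<Sum>x | x \<in> X \<and> L < w x. w x powr (16/5)) \<le> 320 * A * T powr (1/5) + 32 * B * L powr (-24/5)"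
proof (cases "T \<le> L")
  case True
  hence "{x. x \<in> X \<and> L < w x} = {}" using T by fastforce
  thus ?thesis using AB by (simp only: sum.empty) simp
next
  case False
  \<comment> \<open>The number of layers is minimal, so the top layer reaches at most \<open>2 * T\<close>.\<close>
  obtain m where m: "T / L < 2 ^ m" using real_arch_pow[of 2 "T / L"] by auto
  define n where "n = (LEAST n. T \<le> 2 ^ n * L)"
  have ex: "T \<le> 2 ^ m * L" using m L by (simp add: divide_less_eq)
  have n1: "T \<le> 2 ^ n * L" unfolding n_def by (rule LeastI[of "\<lambda>n. T \<le> 2 ^ n * L", OF ex])
  have "n \<noteq> 0" using n1 False by (cases "n = 0") auto
  then obtain n' where n': "n = Suc n'" using not0_implies_Suc by blast
  have "\<not> T \<le> 2 ^ n' * L" using not_less_Least[of n' "\<lambda>n. T \<le> 2 ^ n * L"] n' n_def by simp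
  hence n2: "2 ^ n * L \<le> 2 * T" using n' by simp
  have "{x. x \<in> X \<and> L < w x} = {x. x \<in> X \<and> L < w x \<and> w x \<le> 2 ^ n * L}"
    using T n1 by force
  hence "(\<Sum>x | x \<in> X \<and> L < w x. w x powr (16/5))
      \<le> (\<Sum>k<n. 16 * (A * (2 ^ k * L) powr (1/5) + B * (2 ^ k * L) powr (-24/5)))"
    using layer_sum[OF X L AB N, of n] by simp
  also have "\<dots> = 16 * A * L powr (1/5) * (\<Sum>k<n. (2 powr (1/5)) ^ k)
      + 16 * B * L powr (-24/5) * (\<Sum>k<n. (2 powr (-24/5)) ^ k)"
  proof -
    have pw: "(2 ^ k * L) powr a = L powr a * (2 powr a) ^ k" for k and a :: real
      using L by (simp add: powr_mult power_two_powr mult.commute)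
    show ?thesis unfolding pw sum_distrib_left sum.distrib[symmetric]
      by (intro sum.cong refl) (simp add: algebra_simps)
  qed
  also have "\<dots> \<le> 16 * A * L powr (1/5) * (10 * (2 powr (1/5)) ^ n) + 16 * B * L powr (-24/5) * 2"
    using AB by (intro add_mono mult_left_mono geometric_up geometric_down) auto
  also have "L powr (1/5) * (2 powr (1/5)) ^ n = (2 ^ n * L) powr (1/5)"
    using L by (simp add: powr_mult power_two_powr mult.commute)
  hence "16 * A * L powr (1/5) * (10 * (2 powr (1/5)) ^ n) = 160 * A * (2 ^ n * L) powr (1/5)"
    by (simp add: mult_ac)
  also have "160 * A * (2 ^ n * L) powr (1/5) \<le> 160 * A * (2 * T powr (1/5))"
  proof (rule mult_left_mono)
    have "(2 ^ n * L) powr (1/5) \<le> (2 * T) powr (1/5)" using n2 L by (intro powr_mono2) auto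
    also have "\<dots> = 2 powr (1/5) * T powr (1/5)" using False L by (simp add: powr_mult)
    also have "\<dots> \<le> 2 powr 1 * T powr (1/5)" by (intro mult_right_mono powr_mono) auto
    finally show "(2 ^ n * L) powr (1/5) \<le> 2 * T powr (1/5)" by simp
  qed (use AB in auto)
  finally show ?thesis by simp
qed

context finite_sphere
begin

text \<open>
  The threshold \<open>2 * p powr (2/3)\<close> is where the level bound \<open>p^8 / L^8\<close> meets the bound \<open>p^4 / L\<^sup>2\<close> that
  Plancherel gives; below it Plancherel is used.
\<close>

lemma strong_endpoint:
  assumes f1: "(\<Sum>y\<in>S. (cmod (f y))\<^sup>2) \<le> 1"
  shows "(\<Sum>x\<in>E. cmod (hat S f x) powr (16/5)) \<le> 4000000 * real p powr (24/5)"
proof -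
  define P where "P = real p"
  have P: "P \<ge> 1" using p_pos by (simp add: P_def)
  define L where "L = 2 * P powr (2/3)"
  define T where "T = 2 * P powr (3/2)"
  let ?w = "\<lambda>x. cmod (hat S f x)"
  have L0: "L > 0" using P by (simp add: L_def)
  have "P powr (1/2) \<le> P powr (2/3)" using P by (intro powr_mono) auto
  hence Ls: "L \<ge> 2 * sqrt (real p)" using P by (simp add: L_def P_def powr_half_sqrt)
  have wT: "?w x \<le> T" for x
  proof -
    have "(?w x)\<^sup>2 \<le> 2 * P ^ 3"
      using hat_sup[OF finite_S f1, of x] card_S(2) by (simp add: P_def)
    also have "\<dots> \<le> 4 * P ^ 3" using P by simp
    also have "\<dots> = T\<^sup>2"
      using P powr_add[of P "3/2" "3/2"] by (simp add: T_def power2_eq_square)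
    finally show ?thesis by (rule power2_le_imp_le) (simp add: T_def)
  qed
  have "(\<Sum>x\<in>E. ?w x powr (16/5)) = (\<Sum>x | x \<in> E \<and> L < ?w x. ?w x powr (16/5))
      + (\<Sum>x | x \<in> E \<and> \<not> L < ?w x. ?w x powr (16/5))"
    by (subst sum.union_disjoint[symmetric]) (auto intro!: sum.cong)
  also have "(\<Sum>x | x \<in> E \<and> L < ?w x. ?w x powr (16/5))
      \<le> 320 * (4688 * P ^ 4 * sqrt P) * T powr (1/5) + 32 * (24576 * P ^ 8) * L powr (-24/5)"
  proof (rule weak_to_strong[OF finite_E L0 _ _ _ wT])
    fix t assume t: "t \<ge> L"
    show "real (card {x \<in> E. ?w x > t}) \<le> 4688 * P ^ 4 * sqrt P / t ^ 3 + 24576 * P ^ 8 / t ^ 8"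
      unfolding P_def using t Ls by (intro level_set_bound f1) auto
  qed (use P in auto)
  also have "320 * (4688 * P ^ 4 * sqrt P) * T powr (1/5) \<le> 3000320 * P powr (24/5)"
  proof -
    have "T powr (1/5) = 2 powr (1/5) * P powr (3/10)" using P by (simp add: T_def powr_mult powr_powr)
    also have "\<dots> \<le> 2 powr 1 * P powr (3/10)" by (intro mult_right_mono powr_mono) auto
    finally have "320 * (4688 * P ^ 4 * sqrt P) * T powr (1/5) \<le> 320 * (4688 * P ^ 4 * sqrt P) * (2 * P powr (3/10))"
      using P by (intro mult_left_mono) auto
    also have "P ^ 4 * sqrt P * P powr (3/10) = P powr (24/5)"
      using P powr_add[of P "4 + 1/2" "3/10"] powr_add[of P 4 "1/2"] by (simp add: powr_half_sqrt)
    hence "320 * (4688 * P ^ 4 * sqrt P) * (2 * P powr (3/10)) = 3000320 * P powr (24/5)" by simp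
    finally show ?thesis .
  qed
  also have "32 * (24576 * P ^ 8) * L powr (-24/5) \<le> 786432 * P powr (24/5)"
  proof -
    have "L powr (-24/5) = 2 powr (-24/5) * P powr (-16/5)" using P by (simp add: L_def powr_mult powr_powr)
    also have "\<dots> \<le> 2 powr 0 * P powr (-16/5)" by (intro mult_right_mono powr_mono) auto
    finally have "32 * (24576 * P ^ 8) * L powr (-24/5) \<le> 32 * (24576 * P ^ 8) * P powr (-16/5)"
      using P by (intro mult_left_mono) auto
    also have "P ^ 8 * P powr (-16/5) = P powr (24/5)"
      using P powr_add[of P 8 "-16/5"] by simp
    hence "32 * (24576 * P ^ 8) * P powr (-16/5) = 786432 * P powr (24/5)" by simp
    finally show ?thesis .
  qed
  also have "(\<Sum>x | x \<in> E \<and> \<not> L < ?w x. ?w x powr (16/5)) \<le> 4 * P powr (24/5)"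
  proof -
    have "(\<Sum>x | x \<in> E \<and> \<not> L < ?w x. ?w x powr (16/5)) \<le> (\<Sum>x | x \<in> E \<and> \<not> L < ?w x. L powr (6/5) * (?w x)\<^sup>2)"
    proof (intro sum_mono)
      fix x assume "x \<in> {x. x \<in> E \<and> \<not> L < ?w x}"
      hence "?w x powr (6/5) \<le> L powr (6/5)" by (intro powr_mono2) auto
      hence "?w x powr (6/5) * (?w x)\<^sup>2 \<le> L powr (6/5) * (?w x)\<^sup>2" by (intro mult_right_mono) auto
      moreover have "?w x powr (6/5) * (?w x)\<^sup>2 = ?w x powr (16/5)"
      proof (cases "?w x = 0")
        case False
        thus ?thesis using powr_add[of "?w x" "6/5" 2] by simp
      qed simp
      ultimately show "?w x powr (16/5) \<le> L powr (6/5) * (?w x)\<^sup>2" by simp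
    qed
    also have "\<dots> \<le> (\<Sum>x\<in>E. L powr (6/5) * (?w x)\<^sup>2)" by (intro sum_mono2) auto
    also have "\<dots> = L powr (6/5) * (P ^ 4 * (\<Sum>y\<in>S. (cmod (f y))\<^sup>2))"
      by (simp only: sum_distrib_left[symmetric] plancherel[OF S_sub] P_def)
    also have "\<dots> \<le> L powr (6/5) * (P ^ 4 * 1)"
      using f1 P by (intro mult_left_mono) auto
    also have "\<dots> = 2 powr (6/5) * P powr (24/5)"
      using P powr_add[of P "4/5" 4] by (simp add: L_def powr_mult powr_powr)
    also have "\<dots> \<le> 2 powr 2 * P powr (24/5)" by (intro mult_right_mono powr_mono) auto
    finally show ?thesis by simp
  qed
  finally have "(\<Sum>x\<in>E. ?w x powr (16/5)) \<le> 3000320 * P powr (24/5) + 786432 * P powr (24/5) + 4 * P powr (24/5)"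
    by simp
  also have "\<dots> \<le> 4000000 * P powr (24/5)" by simp
  finally show ?thesis by (simp add: P_def)
qed

lemma strong_type:
  assumes f1: "(\<Sum>y\<in>S. (cmod (f y))\<^sup>2) \<le> 1" and r: "r \<ge> 16 / 5"
  shows "(\<Sum>x\<in>E. cmod (hat S f x) powr r) \<le> 16000000 * real (card S) powr (r / 2)"
proof -
  define n where "n = real (card S)"
  have p0: "real p > 0" using p_pos by simp
  have n: "n > 0" using card_S(1) zero_less_power[OF p0, of 3] unfolding n_def by linarith
  have "(\<Sum>x\<in>E. cmod (hat S f x) powr r) \<le> (\<Sum>x\<in>E. n powr (r / 2 - 8/5) * cmod (hat S f x) powr (16/5))"
  proof (rule sum_mono)
    fix x
    let ?u = "cmod (hat S f x)"
    have "?u \<le> sqrt n" using hat_sup[OF finite_S f1, of x] by (intro real_le_rsqrt) (simp add: n_def)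
    hence "?u powr (r - 16/5) \<le> sqrt n powr (r - 16/5)" using r by (intro powr_mono2) auto
    also have "sqrt n = n powr (1/2)" using n by (simp add: powr_half_sqrt)
    also have "(n powr (1/2)) powr (r - 16/5) = n powr (r / 2 - 8/5)"
      by (simp add: powr_powr algebra_simps)
    finally have "?u powr (r - 16/5) * ?u powr (16/5) \<le> n powr (r / 2 - 8/5) * ?u powr (16/5)"
      by (intro mult_right_mono) auto
    thus "?u powr r \<le> n powr (r / 2 - 8/5) * ?u powr (16/5)" by (simp add: powr_add[symmetric])
  qed
  also have "\<dots> = n powr (r / 2 - 8/5) * (\<Sum>x\<in>E. cmod (hat S f x) powr (16/5))"
    by (simp only: sum_distrib_left)
  also have "\<dots> \<le> n powr (r / 2 - 8/5) * (4000000 * real p powr (24/5))"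
    by (intro mult_left_mono strong_endpoint f1) auto
  also have "real p powr (24/5) = (real p ^ 3) powr (8/5)"
    using p0 powr_powr[of "real p" 3 "8/5"] by simp
  also have "n powr (r / 2 - 8/5) * (4000000 * (real p ^ 3) powr (8/5))
      \<le> n powr (r / 2 - 8/5) * (4000000 * (4 * n powr (8/5)))"
  proof (intro mult_left_mono)
    have "(real p ^ 3) powr (8/5) \<le> (2 * n) powr (8/5)"
      using card_S(1) p0 by (intro powr_mono2) (auto simp: n_def)
    also have "\<dots> = 2 powr (8/5) * n powr (8/5)" using n by (simp add: powr_mult)
    also have "\<dots> \<le> 2 powr 2 * n powr (8/5)" by (intro mult_right_mono powr_mono) auto
    finally show "(real p ^ 3) powr (8/5) \<le> 4 * n powr (8/5)" by simp
  qed auto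
  also have "\<dots> = 16000000 * (n powr (r / 2 - 8/5) * n powr (8/5))" by simp
  also have "n powr (r / 2 - 8/5) * n powr (8/5) = n powr (r / 2)" by (simp add: powr_add[symmetric])
  finally show ?thesis by (simp add: n_def)
qed

end

text \<open>
  The constant is the \<open>r\<close>-th root of the one in \<open>strong_type\<close>: passing from \<open>hat S\<close> to the normalised
  extension operator and norms cancels exactly the power of \<open>|S|\<close> found there.
\<close>

lemma sphere_extension_bound:
  assumes "finite_sphere p j" and j: "j \<in> Fp p" and r: "r \<ge> 16 / 5"
  shows "Lr_norm p r (extension p j f) \<le> 16000000 powr (1 / r) * sphere_L2_norm p j f"
proof -
  interpret finite_sphere p j by fact
  have j_mod: "j mod int p = j" using j by (simp add: Fp_eq)
  have S_eq: "sphere4 p j = S"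
    by (auto simp: sphere4_def S_def Q4_def dt_def cong_def power2_eq_square j_mod)
  have r0: "r > 0" using r by simp
  define n where "n = real (card S)"
  define A where "A = (\<Sum>y\<in>S. (cmod (f y))\<^sup>2)"
  have p0: "real p > 0" using p_pos by simp
  have n: "n > 0" using card_S(1) zero_less_power[OF p0, of 3] unfolding n_def by linarith
  have A0: "A \<ge> 0" by (simp add: A_def sum_nonneg)
  have ext: "extension p j f x = hat S f x / of_real n" for x
  proof -
    have "chi p (dot4 p y x) = e (y \<cdot> x)" for y by (rule chi_cong) (simp add: dot4_def dt_def)
    thus ?thesis by (simp add: extension_def S_eq hat_def n_def)
  qed
  have rhs: "sphere_L2_norm p j f = sqrt (A / n)"
    by (simp add: sphere_L2_norm_def S_eq A_def n_def powr_half_sqrt sum_nonneg)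
  show ?thesis
  proof (cases "A = 0")
    case True
    hence "f y = 0" if "y \<in> S" for y
      using that by (simp add: A_def sum_nonneg_eq_0_iff)
    hence "extension p j f x = 0" for x by (simp add: ext hat_def)
    thus ?thesis using A0 n by (simp add: Lr_norm_def rhs)
  next
    case False
    hence A: "A > 0" using A0 by simp
    define h where "h = (\<lambda>y. f y / of_real (sqrt A))"
    have h1: "(\<Sum>y\<in>S. (cmod (h y))\<^sup>2) \<le> 1"
      using A by (simp add: h_def norm_divide power_divide sum_divide_distrib[symmetric] A_def[symmetric])
    have hh: "cmod (extension p j f x) = sqrt A / n * cmod (hat S h x)" for x
    proof -
      have "hat S f x = of_real (sqrt A) * hat S h x"
        using A by (simp add: hat_def h_def sum_distrib_left)
      thus ?thesis using n A by (simp add: ext norm_divide norm_mult)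
    qed
    have "(\<Sum>x\<in>E. cmod (extension p j f x) powr r) = (sqrt A / n) powr r * (\<Sum>x\<in>E. cmod (hat S h x) powr r)"
      unfolding hh sum_distrib_left by (intro sum.cong refl, subst powr_mult) (use n A in auto)
    also have "\<dots> \<le> (sqrt A / n) powr r * (16000000 * n powr (r / 2))"
      unfolding n_def by (intro mult_left_mono strong_type h1 r) auto
    finally have "Lr_norm p r (extension p j f) \<le> ((sqrt A / n) powr r * (16000000 * n powr (r / 2))) powr (1 / r)"
      unfolding Lr_norm_def using r0 by (intro powr_mono2) (auto intro: sum_nonneg)
    also have "\<dots> = sqrt A / n * (16000000 powr (1 / r) * n powr (1 / 2))"
    proof -
      have "((sqrt A / n) powr r) powr (1 / r) = sqrt A / n" using n A r0 by (simp add: powr_powr)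
      thus ?thesis using r0 by (simp add: powr_mult powr_powr)
    qed
    also have "\<dots> = 16000000 powr (1 / r) * sqrt (A / n)"
    proof -
      have "n powr (1 / 2) = sqrt n" "sqrt n * sqrt n = n" using n by (simp_all add: powr_half_sqrt)
      moreover have "sqrt n > 0" using n by simp
      ultimately show ?thesis by (simp add: real_sqrt_divide field_simps)
    qed
    finally show ?thesis by (simp only: rhs)
  qed
qed

theorem theorem1p1:
  fixes r :: real
  assumes "r \<ge> 16 / 5"
  shows "\<exists>C>0. \<forall>(p::nat) (j::int) (f :: int ^ 4 \<Rightarrow> complex).
           prime p \<longrightarrow> odd p \<longrightarrow> j \<in> Fp p - {0} \<longrightarrow>
           Lr_norm p r (extension p j f) \<le> C * sphere_L2_norm p j f"
proof (intro exI[of _ "16000000 powr (1 / r)"] conjI allI impI)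
  fix p :: nat and j :: int and f :: "int ^ 4 \<Rightarrow> complex"
  assume p: "prime p" "odd p" and j: "j \<in> Fp p - {0}"
  interpret odd_prime p using p by unfold_locales
  have "finite_sphere p j"
    using j nd_F by unfold_locales (auto simp: Fp_eq F_split)
  thus "Lr_norm p r (extension p j f) \<le> 16000000 powr (1 / r) * sphere_L2_norm p j f"
    using j assms by (intro sphere_extension_bound) auto
qed simp

end
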